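(* Let $n\ge 1$ and let $u:\mathbb{R}^n\to\mathbb{R}$ be a smooth function satisfying, for all $x\in\mathbb{R}^n$, $$\arctan\lambda_1(x)+\cdots+\arctan\lambda_n(x)=\frac12\,x\cdot Du(x)-u(x),$$ where $\lambda_1(x),\dots,\lambda_n(x)$ are the eigenvalues of the Hessian $D^2u(x)$. Then $u$ is a quadratic polynomial; precisely, $$u(x)=u(0)+\frac12\langle D^2u(0)\,x,x\rangle\qquad\text{for all }x\in\mathbb{R}^n.$$
   Context: $Du$ and $D^2u$ denote the Euclidean gradient and Hessian matrix of $u$ on $\mathbb{R}^n$; $\cdot$ and $\langle\cdot,\cdot\rangle$ denote the Euclidean inner product; the eigenvalues are counted with multiplicity; $\arctan$ takes values in $(-\pi/2,\pi/2)$. Smooth means $C^\infty$. *)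

theory Defs
  imports
    "HOL-Analysis.Analysis"
    "HOL-Computational_Algebra.Polynomial"
begin

(* The classes C^k on a whole Euclidean space; in finite dimension, f is C^(k+1) iff f is
   differentiable and all its directional derivatives are C^k. *)
primrec C_k :: "nat \<Rightarrow> ('a::euclidean_space \<Rightarrow> 'b::real_normed_vector) \<Rightarrow> bool" where
  "C_k 0 f \<longleftrightarrow> continuous_on UNIV f"
| "C_k (Suc k) f \<longleftrightarrow>
     (\<forall>x. f differentiable (at x)) \<and> (\<forall>v. C_k k (\<lambda>x. frechet_derivative f (at x) v))"

definition smooth :: "('a::euclidean_space \<Rightarrow> 'b::real_normed_vector) \<Rightarrow> bool" where
  "smooth f \<longleftrightarrow> (\<forall>k. C_k k f)"

definition gradient :: "(real ^ 'n \<Rightarrow> real) \<Rightarrow> real ^ 'n \<Rightarrow> real ^ 'n" where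
  "gradient u x = (\<chi> i. frechet_derivative u (at x) (axis i 1))"

definition hessian :: "(real ^ 'n \<Rightarrow> real) \<Rightarrow> real ^ 'n \<Rightarrow> real ^ 'n ^ 'n" where
  "hessian u x = matrix (frechet_derivative (gradient u) (at x))"

(* det (t I - A), as a polynomial in t *)
definition charpoly :: "real ^ 'n ^ 'n \<Rightarrow> real poly" where
  "charpoly A = det (\<chi> i j. if i = j then [:- (A $ i $ j), 1:] else [:- (A $ i $ j):])"

(* Real eigenvalues with algebraic multiplicity; for a symmetric matrix these are all
   CARD('n) eigenvalues, and the algebraic and geometric multiplicities agree. *)
definition eigenvalues :: "real ^ 'n ^ 'n \<Rightarrow> real multiset" where
  "eigenvalues A = proots (charpoly A)"

lemma poly_det: "poly (det M) t = det (\<chi> i j. poly (M $ i $ j) t)"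
  for M :: "'a::comm_ring_1 poly ^ 'n ^ 'n"
  by (simp add: det_def poly_sum poly_prod)

lemma poly_charpoly: "poly (charpoly A) t = det (mat t - A)"
  unfolding charpoly_def poly_det
  by (rule arg_cong[where f = det]) (simp add: vec_eq_iff mat_def)

lemma poly_charpoly_eq_0_iff:
  "poly (charpoly A) t = 0 \<longleftrightarrow> (\<exists>v. v \<noteq> 0 \<and> A *v v = t *\<^sub>R v)"
proof -
  have "mat t *v v = t *\<^sub>R v" for v :: "real ^ 'n"
    by (simp add: vec_eq_iff matrix_vector_mult_def mat_def if_distrib if_distribR cong: if_cong)
  then have "(mat t - A) *v v = 0 \<longleftrightarrow> A *v v = t *\<^sub>R v" for v
    by (metis matrix_vector_mult_diff_rdistrib right_minus_eq)
  moreover have "det (mat t - A) = 0 \<longleftrightarrow> (\<exists>v. v \<noteq> 0 \<and> (mat t - A) *v v = 0)"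
    by (metis invertible_det_nz invertible_left_inverse matrix_left_invertible_ker)
  ultimately show ?thesis
    by (simp add: poly_charpoly)
qed

lemma charpoly_nonzero: "charpoly A \<noteq> 0"
proof
  assume "charpoly A = 0"
  then obtain v where v: "v \<noteq> 0" "A *v v = (onorm ((*v) A) + 1) *\<^sub>R v"
    using poly_charpoly_eq_0_iff[of A "onorm ((*v) A) + 1"] by auto
  have bl: "bounded_linear ((*v) A)"
    by (rule matrix_vector_mul_bounded_linear)
  have "(onorm ((*v) A) + 1) * norm v = norm (A *v v)"
    using v onorm_pos_le[OF bl] by simp
  also have "\<dots> \<le> onorm ((*v) A) * norm v"
    by (rule onorm[OF bl])
  finally show False
    using v by (simp add: algebra_simps)
qed

lemma in_eigenvalues_iff: "t \<in># eigenvalues A \<longleftrightarrow> (\<exists>v. v \<noteq> 0 \<and> A *v v = t *\<^sub>R v)"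
  by (simp add: eigenvalues_def charpoly_nonzero poly_charpoly_eq_0_iff)

lemma GDERIV_gradient:
  assumes "u differentiable (at x)"
  shows "GDERIV u x :> gradient u x"
proof -
  interpret linear "frechet_derivative u (at x)"
    using assms by (rule linear_frechet_derivative)
  have "frechet_derivative u (at x) h = h \<bullet> gradient u x" for h
  proof -
    have "frechet_derivative u (at x) h = frechet_derivative u (at x) (\<Sum>i\<in>UNIV. h $ i *s axis i 1)"
      by (simp add: basis_expansion)
    also have "\<dots> = h \<bullet> gradient u x"
      by (simp add: sum scale scalar_mult_eq_scaleR gradient_def inner_vec_def)
    finally show ?thesis .
  qed
  then have "frechet_derivative u (at x) = (\<lambda>h. h \<bullet> gradient u x)"
    by blast
  with assms show ?thesis
    by (metis frechet_derivative_works gderiv_def)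
qed

end

theory Submission
  imports Defs
begin

text \<open>
  Let \<open>\<Theta>(x) = 1/2 x \<cdot> Du(x) - u(x)\<close>, which by the equation is the phase \<open>\<Sum> arctan \<lambda>\<^sub>i\<close> and hence bounded.
  Differentiating both expressions gives \<open>tr (g\<^sup>-\<^sup>1 D\<^sup>2\<Theta>) = 1/2 x \<cdot> D\<Theta>\<close> with \<open>g = I + (D\<^sup>2u)\<^sup>2\<close>, an elliptic
  equation whose drift points inwards, and \<open>g\<^sup>-\<^sup>1 \<le> I\<close>. Outside any ball around the origin there is a radial
  strict supersolution \<open>f(|x|\<^sup>2)\<close> tending to infinity; comparison with small multiples of it shows that
  \<open>\<Theta>\<close> on the exterior of the ball is bounded by its maximum on the sphere. Letting the ball shrink,
  \<open>\<Theta> \<le> \<Theta>(0)\<close>, and likewise \<open>- \<Theta> \<le> - \<Theta>(0)\<close>. Once \<open>\<Theta>\<close> is constant, Euler's relation makes \<open>u - u(0)\<close>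
  homogeneous of degree two, and a function of this kind that is twice differentiable at the origin
  is a quadratic form.
\<close>

section \<open>Directional derivatives\<close>

definition dird :: "'a::euclidean_space \<Rightarrow> ('a \<Rightarrow> real) \<Rightarrow> 'a \<Rightarrow> real" where
  "dird v f x = frechet_derivative f (at x) v"

lemma C_k_SucD:
  assumes "C_k (Suc k) f"
  shows "f differentiable (at x)" and "C_k k (dird v f)"
  using assms by (auto simp: dird_def[abs_def])

lemma smooth_differentiable: "smooth (f :: 'a::euclidean_space \<Rightarrow> real) \<Longrightarrow> f differentiable (at x)"
  unfolding smooth_def using C_k_SucD(1)[of 0 f x] by blast

lemma smooth_dird: "smooth f \<Longrightarrow> smooth (dird v f)"
  unfolding smooth_def by (metis C_k_SucD(2))

lemma smooth_continuous_on: "smooth f \<Longrightarrow> continuous_on S f"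
  unfolding smooth_def by (metis C_k.simps(1) continuous_on_subset subset_UNIV)

lemma dird_add:
  "f differentiable (at x) \<Longrightarrow> dird (v + w) f x = dird v f x + dird w f x"
  unfolding dird_def by (rule linear_add[OF linear_frechet_derivative])

lemma dird_scaleR:
  "f differentiable (at x) \<Longrightarrow> dird (c *\<^sub>R v) f x = c * dird v f x"
  unfolding dird_def
  using linear_scale[OF linear_frechet_derivative] by fastforce

lemma has_real_derivative_along_line:
  assumes "f differentiable (at (a + t *\<^sub>R v))"
  shows "((\<lambda>t. f (a + t *\<^sub>R v)) has_real_derivative dird v f (a + t *\<^sub>R v)) (at t)"
proof -
  have l: "((\<lambda>t. a + t *\<^sub>R v) has_derivative (\<lambda>h. h *\<^sub>R v)) (at t)"
    by (auto intro!: derivative_eq_intros)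
  have "((\<lambda>t. f (a + t *\<^sub>R v)) has_derivative
      (\<lambda>h. frechet_derivative f (at (a + t *\<^sub>R v)) (h *\<^sub>R v))) (at t)"
    using has_derivative_compose[OF l] assms frechet_derivative_works by blast
  moreover have "frechet_derivative f (at (a + t *\<^sub>R v)) (h *\<^sub>R v) = dird v f (a + t *\<^sub>R v) * h" for h
    using dird_scaleR[OF assms, of h v] by (simp add: dird_def)
  ultimately show ?thesis
    by (simp add: has_field_derivative_def)
qed

section \<open>Symmetry of mixed second derivatives\<close>

text \<open>The mean value theorem is applied twice: in direction \<open>v\<close> to the difference
  of \<open>f\<close> along two parallel sides of the parallelogram, then in direction
  \<open>w\<close> to \<open>dird v f\<close>. The left side is symmetric in \<open>v\<close> and
  \<open>w\<close>.\<close>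

lemma rectangle_increment_eq_dird:
  fixes f :: "'a::euclidean_space \<Rightarrow> real"
  assumes f: "\<And>x. f differentiable (at x)" and g: "\<And>x. dird v f differentiable (at x)"
    and "0 < h"
  shows "\<exists>s r. 0 < s \<and> s < h \<and> 0 < r \<and> r < h \<and>
    f (x + h *\<^sub>R v + h *\<^sub>R w) - f (x + h *\<^sub>R v) - f (x + h *\<^sub>R w) + f x
      = h\<^sup>2 * dird w (dird v f) (x + s *\<^sub>R v + r *\<^sub>R w)"
proof -
  have "\<exists>s>0. s < h \<and> (f ((x + h *\<^sub>R w) + h *\<^sub>R v) - f (x + h *\<^sub>R v)) - (f ((x + h *\<^sub>R w) + 0 *\<^sub>R v) - f (x + 0 *\<^sub>R v))
      = (h - 0) * (dird v f ((x + h *\<^sub>R w) + s *\<^sub>R v) - dird v f (x + s *\<^sub>R v))"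
    by (rule MVT2[OF \<open>0 < h\<close>]) (intro derivative_intros has_real_derivative_along_line f)
  then obtain s where s: "0 < s" "s < h"
    and se: "f (x + h *\<^sub>R w + h *\<^sub>R v) - f (x + h *\<^sub>R v) - (f (x + h *\<^sub>R w) - f x)
      = h * (dird v f (x + h *\<^sub>R w + s *\<^sub>R v) - dird v f (x + s *\<^sub>R v))"
    by auto
  have "\<exists>r>0. r < h \<and> dird v f ((x + s *\<^sub>R v) + h *\<^sub>R w) - dird v f ((x + s *\<^sub>R v) + 0 *\<^sub>R w)
      = (h - 0) * dird w (dird v f) ((x + s *\<^sub>R v) + r *\<^sub>R w)"
    by (rule MVT2[OF \<open>0 < h\<close>]) (intro has_real_derivative_along_line g)
  then obtain r where r: "0 < r" "r < h"
    and re: "dird v f (x + s *\<^sub>R v + h *\<^sub>R w) - dird v f (x + s *\<^sub>R v)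
      = h * dird w (dird v f) (x + s *\<^sub>R v + r *\<^sub>R w)"
    by auto
  show ?thesis
    using s r se re by (intro exI[of _ s] exI[of _ r]) (simp add: power2_eq_square algebra_simps)
qed

lemma isCont_two_directions:
  fixes G :: "'a::euclidean_space \<Rightarrow> real"
  assumes "isCont G x" "0 < e"
  shows "\<exists>d>0. \<forall>s r. 0 < s \<and> s < d \<and> 0 < r \<and> r < d \<longrightarrow> \<bar>G (x + s *\<^sub>R v + r *\<^sub>R w) - G x\<bar> < e"
proof -
  obtain d where d: "0 < d" "\<And>y. dist y x < d \<Longrightarrow> dist (G y) (G x) < e"
    using assms unfolding continuous_at_eps_delta by blast
  define m where "m = norm v + norm w + 1"
  have m: "m > 0" by (simp add: m_def add_nonneg_pos)
  have "\<bar>G (x + s *\<^sub>R v + r *\<^sub>R w) - G x\<bar> < e" if "0 < s" "s < d / m" "0 < r" "r < d / m" for s r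
  proof -
    have "norm (s *\<^sub>R v + r *\<^sub>R w) \<le> s * norm v + r * norm w"
      using norm_triangle_ineq[of "s *\<^sub>R v" "r *\<^sub>R w"] that by simp
    also have "\<dots> \<le> (d / m) * norm v + (d / m) * norm w"
      using that by (intro add_mono mult_right_mono) auto
    also have "\<dots> = d * (norm v + norm w) / m"
      by (simp add: add_divide_distrib distrib_left)
    also have "\<dots> < d"
      using m d(1) by (simp add: field_simps m_def)
    finally show ?thesis
      using d(2)[of "x + s *\<^sub>R v + r *\<^sub>R w"] by (simp add: dist_norm add.assoc)
  qed
  then show ?thesis using m d(1) by (intro exI[of _ "d / m"]) auto
qed

text \<open>Schwarz's theorem: the same increment equals \<open>h\<^sup>2\<close> times either mixed
  derivative at nearby intermediate points, and both mixed derivatives are continuous.\<close>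

lemma dird_commute:
  fixes f :: "'a::euclidean_space \<Rightarrow> real"
  assumes "C_k 2 f"
  shows "dird v (dird w f) x = dird w (dird v f) x"
proof -
  have C: "C_k (Suc (Suc 0)) f" using assms by (simp add: numeral_2_eq_2)
  have f: "f differentiable (at y)" for y using C_k_SucD(1)[OF C] .
  have g: "dird u f differentiable (at y)" for u y using C_k_SucD(1)[OF C_k_SucD(2)[OF C]] .
  have c: "isCont (dird u (dird u' f)) y" for u u' y
    using C_k_SucD(2)[OF C_k_SucD(2)[OF C], of u u'] continuous_on_eq_continuous_at[of UNIV] by auto
  have "\<bar>dird v (dird w f) x - dird w (dird v f) x\<bar> \<le> e" if "0 < e" for e
  proof -
    have e2: "0 < e / 2" using that by simp
    obtain d1 where d1: "d1 > 0" "\<And>s r. \<lbrakk>0 < s; s < d1; 0 < r; r < d1\<rbrakk> \<Longrightarrow>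
        \<bar>dird w (dird v f) (x + s *\<^sub>R v + r *\<^sub>R w) - dird w (dird v f) x\<bar> < e / 2"
      using isCont_two_directions[OF c e2, of w v x v w] by blast
    obtain d2 where d2: "d2 > 0" "\<And>s r. \<lbrakk>0 < s; s < d2; 0 < r; r < d2\<rbrakk> \<Longrightarrow>
        \<bar>dird v (dird w f) (x + s *\<^sub>R w + r *\<^sub>R v) - dird v (dird w f) x\<bar> < e / 2"
      using isCont_two_directions[OF c e2, of v w x w v] by blast
    define h where "h = min d1 d2 / 2"
    have h: "h > 0" "h < d1" "h < d2" using d1(1) d2(1) by (auto simp: h_def)
    obtain s r where sr: "0 < s" "s < h" "0 < r" "r < h"
      "f (x + h *\<^sub>R v + h *\<^sub>R w) - f (x + h *\<^sub>R v) - f (x + h *\<^sub>R w) + f x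
      = h\<^sup>2 * dird w (dird v f) (x + s *\<^sub>R v + r *\<^sub>R w)"
      using rectangle_increment_eq_dird[of f v h x w, OF f g h(1)] by blast
    obtain s' r' where sr': "0 < s'" "s' < h" "0 < r'" "r' < h"
      "f (x + h *\<^sub>R w + h *\<^sub>R v) - f (x + h *\<^sub>R w) - f (x + h *\<^sub>R v) + f x
      = h\<^sup>2 * dird v (dird w f) (x + s' *\<^sub>R w + r' *\<^sub>R v)"
      using rectangle_increment_eq_dird[of f w h x v, OF f g h(1)] by blast
    have "h\<^sup>2 * dird w (dird v f) (x + s *\<^sub>R v + r *\<^sub>R w) = h\<^sup>2 * dird v (dird w f) (x + s' *\<^sub>R w + r' *\<^sub>R v)"
      using sr(5) sr'(5) by (simp add: algebra_simps)
    then have "dird w (dird v f) (x + s *\<^sub>R v + r *\<^sub>R w) = dird v (dird w f) (x + s' *\<^sub>R w + r' *\<^sub>R v)"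
      using h(1) by simp
    moreover have "\<bar>dird w (dird v f) (x + s *\<^sub>R v + r *\<^sub>R w) - dird w (dird v f) x\<bar> < e / 2"
      using d1(2) sr h by simp
    moreover have "\<bar>dird v (dird w f) (x + s' *\<^sub>R w + r' *\<^sub>R v) - dird v (dird w f) x\<bar> < e / 2"
      using d2(2) sr' h by simp
    ultimately show ?thesis by linarith
  qed
  then have "\<bar>dird v (dird w f) x - dird w (dird v f) x\<bar> \<le> 0"
    by (rule field_le_epsilon[of _ 0, simplified]) auto
  then show ?thesis by simp
qed

lemma smooth_dird_commute: "smooth f \<Longrightarrow> dird v (dird w f) = dird w (dird v f)"
  using dird_commute unfolding smooth_def by blast

section \<open>Second derivative test and Euler's relation along a ray\<close>

text \<open>A maximum at 0 gives \<open>g' 0 = 0\<close>. With \<open>H > 0\<close>,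
  \<open>g'\<close> would be positive just to the right of 0, and \<open>g\<close> would rise above
  \<open>g 0\<close>.\<close>

lemma second_derivative_local_max:
  fixes g g' :: "real \<Rightarrow> real"
  assumes g: "\<And>t. (g has_real_derivative g' t) (at t)"
    and g': "(g' has_real_derivative H) (at 0)"
    and "0 < d" and max: "\<And>t. \<bar>t\<bar> < d \<Longrightarrow> g t \<le> g 0"
  shows "H \<le> 0"
proof (rule ccontr)
  assume "\<not> H \<le> 0"
  then obtain b where b: "b > 0" "\<And>h. 0 < h \<Longrightarrow> h < b \<Longrightarrow> g' 0 < g' (0 + h)"
    using DERIV_pos_inc_right[OF g'] by auto
  have "g' 0 = 0"
    by (rule DERIV_local_max[OF g \<open>0 < d\<close>]) (use max in auto)
  define h where "h = min b d / 2"
  have h: "0 < h" "h < b" "h < d" using b(1) \<open>0 < d\<close> by (auto simp: h_def)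
  obtain z where z: "0 < z" "z < h" "g h - g 0 = (h - 0) * g' z"
    using MVT2[OF h(1), of g g'] g by blast
  have "g' z > 0" using b(2)[of z] z h \<open>g' 0 = 0\<close> by auto
  then have "g h > g 0" using z h by (metis diff_gt_0_iff_gt diff_zero mult_pos_pos)
  then show False using max[of h] h by auto
qed

text \<open>Euler's relation makes \<open>f (t *\<^sub>R x) / t\<^sup>2\<close> constant for
  positive \<open>t\<close>, so the first derivative along the ray is \<open>2 * f x * t\<close>.
  Its slope at the origin, taken from the right, is the second derivative there.\<close>

lemma radial_derivative_double:
  fixes f :: "'a::euclidean_space \<Rightarrow> real"
  assumes f: "\<And>x. f differentiable (at x)" and "f 0 = 0" and e: "\<And>x. dird x f x = 2 * f x"
    and g: "\<And>x. dird x f differentiable (at 0)"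
  shows "f x = 1 / 2 * dird x (dird x f) 0"
proof -
  have line: "((\<lambda>t. f (t *\<^sub>R x)) has_real_derivative dird x f (t *\<^sub>R x)) (at t)" for t
    using has_real_derivative_along_line[of f 0 t x] f by simp
  have td: "t * dird x f (t *\<^sub>R x) = 2 * f (t *\<^sub>R x)" for t
    using e[of "t *\<^sub>R x"] dird_scaleR[OF f] by simp
  have "\<exists>c. \<forall>t\<in>{0<..}. f (t *\<^sub>R x) / t\<^sup>2 = c"
  proof (rule has_field_derivative_zero_constant)
    show "convex {(0::real)<..}" by simp
    fix t :: real assume "t \<in> {0<..}"
    then have t: "t > 0" by simp
    have "((\<lambda>t. f (t *\<^sub>R x) / t\<^sup>2) has_real_derivative
        (dird x f (t *\<^sub>R x) * t\<^sup>2 - f (t *\<^sub>R x) * (2 * t)) / (t\<^sup>2 * t\<^sup>2)) (at t)"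
      using t by (auto intro!: derivative_eq_intros line)
    moreover have "dird x f (t *\<^sub>R x) * t\<^sup>2 - f (t *\<^sub>R x) * (2 * t) = 0"
      using td[of t] by (simp add: power2_eq_square) (metis mult.assoc mult.commute)
    ultimately show "((\<lambda>t. f (t *\<^sub>R x) / t\<^sup>2) has_real_derivative 0) (at t within {0<..})"
      by (metis div_0 DERIV_subset subset_UNIV)
  qed
  then obtain c where c: "\<And>t. t > 0 \<Longrightarrow> f (t *\<^sub>R x) / t\<^sup>2 = c" by auto
  have "c = f x" using c[of 1] by simp
  have quad: "dird x f (t *\<^sub>R x) = 2 * f x * t" if "t > 0" for t
    using c[OF that] td[of t] that \<open>c = f x\<close> by (simp add: field_simps power2_eq_square)
  have d0: "((\<lambda>t. dird x f (t *\<^sub>R x)) has_real_derivative dird x (dird x f) 0) (at 0)"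
    using has_real_derivative_along_line[of "dird x f" 0 0 x] g by simp
  then have cont: "((\<lambda>t. dird x f (t *\<^sub>R x)) \<longlongrightarrow> dird x f 0) (at_right 0)"
    using DERIV_isCont[OF d0] by (simp add: isCont_def filterlim_at_split)
  have ev: "eventually (\<lambda>t. dird x f (t *\<^sub>R x) = 2 * f x * t) (at_right 0)"
    using quad by (auto simp: eventually_at_filter)
  have "((\<lambda>t. 2 * f x * t) \<longlongrightarrow> 0) (at_right 0)"
    by (auto intro!: tendsto_eq_intros)
  then have "((\<lambda>t. dird x f (t *\<^sub>R x)) \<longlongrightarrow> 0) (at_right 0)"
    using ev by (simp cong: tendsto_cong)
  then have z: "dird x f 0 = 0"
    using cont tendsto_unique trivial_limit_at_right_real by blast
  have "((\<lambda>t. (dird x f (t *\<^sub>R x) - dird x f 0) / t) \<longlongrightarrow> dird x (dird x f) 0) (at_right 0)"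
    using d0 by (simp add: has_field_derivative_iff filterlim_at_split)
  moreover have "eventually (\<lambda>t. (dird x f (t *\<^sub>R x) - dird x f 0) / t = 2 * f x) (at_right 0)"
    using quad z by (auto simp: eventually_at_filter)
  ultimately have "((\<lambda>t. 2 * f x) \<longlongrightarrow> dird x (dird x f) 0) (at_right (0::real))"
    by (simp cong: tendsto_cong)
  then have "dird x (dird x f) 0 = 2 * f x"
    by (metis tendsto_const tendsto_unique trivial_limit_at_right_real)
  then show ?thesis by simp
qed

section \<open>Symmetric matrices\<close>

text \<open>A maximizer of the Rayleigh quotient on the unit sphere of \<open>S\<close> is an
  eigenvector: otherwise a small move in the direction of the residual \<open>w\<close> would
  increase the quotient.\<close>

lemma selfadjoint_eigenvector_exists:
  fixes f :: "'a::euclidean_space \<Rightarrow> 'a"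
  assumes f: "linear f" and sa: "\<And>x y. f x \<bullet> y = x \<bullet> f y"
    and S: "subspace S" "f ` S \<subseteq> S" "S \<noteq> {0}"
  shows "\<exists>x\<in>S. norm x = 1 \<and> (\<exists>l. f x = l *\<^sub>R x)"
proof -
  define K where "K = S \<inter> sphere 0 1"
  obtain z where z: "z \<in> S" "z \<noteq> 0"
    using S(1,3) subspace_0 by blast
  then have "z /\<^sub>R norm z \<in> K"
    using S(1) by (auto simp: K_def subspace_scale)
  moreover have "compact K"
    unfolding K_def using S(1) by (intro closed_Int_compact closed_subspace) auto
  moreover have "continuous_on K (\<lambda>x. x \<bullet> f x)"
    by (intro continuous_intros linear_continuous_on linear_conv_bounded_linear[THEN iffD1] f)
  ultimately obtain x where x: "x \<in> K" and max: "\<And>y. y \<in> K \<Longrightarrow> y \<bullet> f y \<le> x \<bullet> f x"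
    using continuous_attains_sup[of K "\<lambda>x. x \<bullet> f x"] by blast
  define l where "l = x \<bullet> f x"
  have x1: "x \<in> S" "norm x = 1" using x by (auto simp: K_def)
  have max': "y \<bullet> f y \<le> l * (y \<bullet> y)" if "y \<in> S" for y
  proof (cases "y = 0")
    case False
    have "y /\<^sub>R norm y \<in> K"
      using S(1) that False by (auto simp: K_def subspace_scale)
    from max[OF this] have "y \<bullet> f y / (norm y * norm y) \<le> l"
      by (simp add: linear_scale[OF f] l_def divide_inverse mult.commute mult.left_commute)
    then show ?thesis
      using False by (simp add: divide_le_eq dot_square_norm power2_eq_square)
  qed (simp add: linear_0[OF f])
  define w where "w = f x - l *\<^sub>R x"
  have wS: "w \<in> S"
    unfolding w_def using x1 S(1,2) by (intro subspace_diff subspace_scale) auto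
  define C where "C = l * (w \<bullet> w) - w \<bullet> f w"
  \<comment> \<open>Maximality of \<open>x\<close> tested at \<open>x + t *\<^sub>R w\<close> and
    divided by \<open>t\<close>. Letting \<open>t\<close> tend to 0 forces
    \<open>w = 0\<close>.\<close>
  have ineq: "2 * (w \<bullet> w) \<le> t * C" if "t > 0" for t
  proof -
    have "x + t *\<^sub>R w \<in> S" using x1 wS S(1) by (intro subspace_add subspace_scale)
    from max'[OF this]
    have "x \<bullet> f x + t * (x \<bullet> f w) + t * (w \<bullet> f x) + t * t * (w \<bullet> f w)
      \<le> l * (x \<bullet> x) + 2 * t * l * (x \<bullet> w) + t * t * l * (w \<bullet> w)"
      by (simp add: linear_add[OF f] linear_scale[OF f] inner_simps algebra_simps inner_commute)
    moreover have "x \<bullet> f w = w \<bullet> f x" by (metis sa inner_commute)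
    moreover have "x \<bullet> x = 1" using x1 by (simp add: dot_square_norm)
    moreover have "w \<bullet> w = w \<bullet> f x - l * (x \<bullet> w)"
      by (subst (2) w_def) (simp add: inner_simps inner_commute)
    from arg_cong[OF this, of "\<lambda>s. 2 * t * s"]
    have "t * (2 * (w \<bullet> w)) = 2 * (t * (w \<bullet> f x)) - 2 * t * l * (x \<bullet> w)"
      by (simp add: algebra_simps)
    moreover have "t * (t * C) = t * t * l * (w \<bullet> w) - t * t * (w \<bullet> f w)"
      by (simp add: C_def algebra_simps)
    ultimately have "t * (2 * (w \<bullet> w)) \<le> t * (t * C)"
      by (simp add: l_def[symmetric])
    then show ?thesis using that by simp
  qed
  have "2 * (w \<bullet> w) \<le> 0"
  proof (rule field_le_epsilon)
    fix e :: real assume e: "e > 0"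
    have "2 * (w \<bullet> w) \<le> e / (\<bar>C\<bar> + 1) * C"
      using e by (intro ineq) simp
    also have "\<dots> \<le> e / (\<bar>C\<bar> + 1) * (\<bar>C\<bar> + 1)"
      using e by (intro mult_left_mono) auto
    also have "\<dots> = 0 + e" by simp
    finally show "2 * (w \<bullet> w) \<le> 0 + e" .
  qed
  then have "w = 0" by (metis inner_ge_zero inner_eq_zero_iff mult_le_0_iff antisym not_numeral_le_zero)
  then show ?thesis using x1 by (auto simp: w_def)
qed

text \<open>Induction on the dimension: once a unit eigenvector is split off, self-adjointness keeps
  its orthogonal complement in \<open>S\<close> invariant. The claim concerns subspaces so that this
  complement is again an instance.\<close>

lemma selfadjoint_orthonormal_eigenbasis:
  fixes f :: "'a::euclidean_space \<Rightarrow> 'a"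
  assumes f: "linear f" and sa: "\<And>x y. f x \<bullet> y = x \<bullet> f y"
    and "subspace S" "f ` S \<subseteq> S"
  shows "\<exists>B \<subseteq> S. finite B \<and> card B = dim S \<and> pairwise orthogonal B \<and>
    (\<forall>x\<in>B. norm x = 1 \<and> (\<exists>l. f x = l *\<^sub>R x))"
  using assms(3,4)
proof (induction "dim S" arbitrary: S)
  case 0
  then show ?case by (intro exI[of _ "{}"]) auto
next
  case (Suc n)
  have "S \<noteq> {0}" using Suc.hyps(2) by auto
  then obtain x l where x: "x \<in> S" "norm x = 1" "f x = l *\<^sub>R x"
    using selfadjoint_eigenvector_exists[OF f sa Suc.prems] by blast
  define T where "T = {y \<in> S. \<forall>z\<in>span {x}. orthogonal z y}"
  have T: "T = {y \<in> S. x \<bullet> y = 0}"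
    unfolding T_def orthogonal_def by (auto simp: span_singleton)
  have "dim T + dim (span {x}) = dim S"
    unfolding T_def using x(1) Suc.prems(1)
    by (intro dim_subspace_orthogonal_to_vectors) (auto simp: span_minimal)
  moreover have "dim (span {x}) = 1"
    using x(2) by (auto simp: dim_span)
  ultimately have dT: "n = dim T" using Suc.hyps(2) by simp
  have sT: "subspace T"
    unfolding T using Suc.prems(1)
    by (auto simp: subspace_def inner_right_distrib)
  have "f ` T \<subseteq> T"
  proof
    fix y assume "y \<in> f ` T"
    then obtain z where z: "z \<in> S" "x \<bullet> z = 0" "y = f z" by (auto simp: T)
    then have "x \<bullet> f z = 0" using sa[of x z] x(3) by simp
    then show "y \<in> T" using z Suc.prems(2) by (auto simp: T)
  qed
  then obtain B where B: "B \<subseteq> T" "finite B" "card B = dim T" "pairwise orthogonal B"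
    "\<forall>x\<in>B. norm x = 1 \<and> (\<exists>l. f x = l *\<^sub>R x)"
    using Suc.hyps(1)[OF dT sT] by blast
  have "x \<notin> T" using x(2) by (auto simp: T)
  then have "x \<notin> B" using B(1) by blast
  moreover have "pairwise orthogonal (insert x B)"
    using B(1,4) by (auto simp: pairwise_insert T orthogonal_def inner_commute)
  ultimately show ?case
    using B x dT Suc.hyps(2) by (intro exI[of _ "insert x B"]) (auto simp: T)
qed

text \<open>An indexed family rather than a set, so that eigenvalues can carry the same index and
  repeated ones are counted.\<close>

definition orthonormal_family :: "('i \<Rightarrow> 'a::real_inner) \<Rightarrow> bool" where
  "orthonormal_family e \<longleftrightarrow> (\<forall>i j. e i \<bullet> e j = (if i = j then 1 else 0))"

lemma symmetric_matrix_orthonormal_eigenbasis: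
  fixes A :: "real ^ 'n ^ 'n"
  assumes "transpose A = A"
  shows "\<exists>(e :: 'n \<Rightarrow> real ^ 'n) l. orthonormal_family e \<and> (\<forall>i. A *v e i = l i *\<^sub>R e i)"
proof -
  have sa: "(A *v x) \<bullet> y = x \<bullet> (A *v y)" for x y
    by (metis assms dot_lmul_matrix inner_commute transpose_matrix_vector vector_transpose_matrix)
  have "linear ((*v) A)" by simp
  from selfadjoint_orthonormal_eigenbasis[OF this sa, of UNIV]
  obtain B where B: "finite B" "card B = CARD('n)" "pairwise orthogonal B"
    "\<And>x. x \<in> B \<Longrightarrow> norm x = 1" "\<And>x. x \<in> B \<Longrightarrow> \<exists>l. A *v x = l *\<^sub>R x"
    by auto
  obtain e where e: "bij_betw e (UNIV :: 'n set) B"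
    using B(1,2) finite_same_card_bij[of "UNIV :: 'n set" B] by auto
  have eB: "e i \<in> B" for i using e by (auto simp: bij_betw_def)
  have "e i \<bullet> e j = (if i = j then 1 else 0)" for i j
    using B(3,4) eB[of i] eB[of j] e
    by (auto simp: pairwise_def orthogonal_def dot_square_norm bij_betw_def inj_eq)
  moreover obtain l where "\<And>i. A *v e i = l i *\<^sub>R e i"
    using B(5)[OF eB] by metis
  ultimately show ?thesis unfolding orthonormal_family_def by blast
qed

section \<open>Characteristic polynomial in an orthonormal basis\<close>

lemma orthonormal_family_matrix:
  fixes e :: "'n \<Rightarrow> real ^ 'n"
  assumes "orthonormal_family e"
  shows "(\<chi> i j. e i $ j) ** transpose (\<chi> i j. e i $ j) = mat 1"
  using assms by (simp add: vec_eq_iff matrix_matrix_mult_def transpose_def mat_def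
      orthonormal_family_def inner_vec_def)

text \<open>This is \<open>Q ** A ** transpose Q\<close>, where the rows of \<open>Q\<close> are the
  vectors \<open>e i\<close>. It is given by entries because these are differentiated later, with
  \<open>e\<close> held fixed.\<close>

definition in_basis :: "('n \<Rightarrow> real ^ 'n) \<Rightarrow> real ^ 'n ^ 'n \<Rightarrow> real ^ 'n ^ 'n" where
  "in_basis e A = (\<chi> i j. e i \<bullet> (A *v e j))"

text \<open>Conjugation by \<open>Q\<close> fixes \<open>mat t\<close>, and the determinants of
  \<open>Q\<close> and its transpose multiply to 1. Agreement of the values at all \<open>t\<close>
  gives equality of the polynomials.\<close>

lemma charpoly_in_basis:
  fixes e :: "'n \<Rightarrow> real ^ 'n"
  assumes "orthonormal_family e"
  shows "charpoly (in_basis e A) = charpoly A"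
proof -
  define Q :: "real ^ 'n ^ 'n" where "Q = (\<chi> i j. e i $ j)"
  have QQ: "Q ** transpose Q = mat 1"
    unfolding Q_def by (rule orthonormal_family_matrix[OF assms])
  have B: "in_basis e A = Q ** (A ** transpose Q)"
    by (simp add: vec_eq_iff in_basis_def Q_def matrix_vector_mult_def
        matrix_matrix_mult_def transpose_def inner_vec_def)
  have dQ: "det Q * det (transpose Q) = 1"
    using QQ by (metis det_I det_mul)
  have "poly (charpoly (in_basis e A)) t = poly (charpoly A) t" for t
  proof -
    have t: "mat t = t *\<^sub>R (mat 1 :: real ^ 'n ^ 'n)"
      by (simp add: vec_eq_iff mat_def)
    have "Q ** (mat t ** transpose Q) = mat t"
      unfolding t using QQ by (simp only: scalar_matrix_assoc[symmetric] matrix_scalar_ac matrix_mul_lid)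
    moreover have "Q ** ((mat t - A) ** transpose Q) + Q ** (A ** transpose Q) = Q ** (mat t ** transpose Q)"
      by (simp add: vec_eq_iff matrix_matrix_mult_def left_diff_distrib right_diff_distrib
          sum_subtractf)
    ultimately have "mat t - in_basis e A = Q ** ((mat t - A) ** transpose Q)"
      by (simp add: B algebra_simps)
    then show ?thesis
      unfolding poly_charpoly using dQ by (simp add: det_mul)
  qed
  then show ?thesis by (simp add: poly_eq_poly_eq_iff[symmetric] fun_eq_iff)
qed

lemma charpoly_diagonal:
  assumes "\<And>i j. i \<noteq> j \<Longrightarrow> A $ i $ j = 0"
  shows "charpoly A = (\<Prod>i\<in>UNIV. [:- (A $ i $ i), 1:])"
  unfolding charpoly_def using assms by (subst det_diagonal) auto

lemma in_eigenbasis: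
  assumes "orthonormal_family e" "\<And>i. A *v e i = l i *\<^sub>R e i"
  shows "in_basis e A $ i $ j = (if i = j then l i else 0)"
  using assms by (simp add: in_basis_def orthonormal_family_def)

lemma charpoly_eigenbasis:
  fixes e :: "'n \<Rightarrow> real ^ 'n"
  assumes "orthonormal_family e" "\<And>i. A *v e i = l i *\<^sub>R e i"
  shows "charpoly A = (\<Prod>i\<in>UNIV. [:- l i, 1:])"
  using charpoly_diagonal[of "in_basis e A"] charpoly_in_basis[OF assms(1), of A]
    in_eigenbasis[of e A l, OF assms] by simp

lemma eigenvalues_eigenbasis:
  fixes e :: "'n \<Rightarrow> real ^ 'n"
  assumes "orthonormal_family e" "\<And>i. A *v e i = l i *\<^sub>R e i"
  shows "eigenvalues A = image_mset l (mset_set UNIV)"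
proof -
  have "eigenvalues A = (\<Sum>i\<in>UNIV. {#l i#})"
    unfolding eigenvalues_def charpoly_eigenbasis[OF assms] by (subst proots_prod) auto
  also have "\<dots> = image_mset l (mset_set UNIV)"
    by (simp add: sum_unfold_sum_mset)
  finally show ?thesis .
qed

lemma sum_eigenvalues_eigenbasis:
  fixes e :: "'n \<Rightarrow> real ^ 'n"
  assumes "orthonormal_family e" "\<And>i. A *v e i = l i *\<^sub>R e i"
  shows "(\<Sum>l\<in>#eigenvalues A. f l) = (\<Sum>i\<in>UNIV. f (l i))"
  unfolding eigenvalues_eigenbasis[OF assms]
  by (simp add: sum_unfold_sum_mset image_mset.compositionality comp_def)

section \<open>Differentiating the phase\<close>

text \<open>A permutation other than the identity moves at least two indices, so at a diagonal matrix
  its term in the Leibniz formula vanishes to second order.\<close>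

lemma det_has_vector_derivative_diagonal:
  fixes M :: "real \<Rightarrow> 'a::real_normed_field ^ 'n ^ 'n"
  assumes d: "\<And>i j. ((\<lambda>t. M t $ i $ j) has_vector_derivative M' i j) (at a)"
    and diag: "\<And>i j. i \<noteq> j \<Longrightarrow> M a $ i $ j = 0"
  shows "((\<lambda>t. det (M t)) has_vector_derivative (\<Sum>i\<in>UNIV. M' i i * (\<Prod>j\<in>UNIV - {i}. M a $ j $ j))) (at a)"
proof -
  let ?P = "{p. p permutes (UNIV :: 'n set)}"
  define D where "D p = (\<Sum>i\<in>UNIV. M' i (p i) * (\<Prod>j\<in>UNIV - {i}. M a $ j $ p j))" for p
  have "((\<lambda>t. \<Prod>i\<in>UNIV. M t $ i $ p i) has_derivative
      (\<lambda>h. \<Sum>i\<in>UNIV. (h *\<^sub>R M' i (p i)) * (\<Prod>j\<in>UNIV - {i}. M a $ j $ p j))) (at a)" for p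
    using d unfolding has_vector_derivative_def by (intro has_derivative_prod) auto
  then have p: "((\<lambda>t. \<Prod>i\<in>UNIV. M t $ i $ p i) has_vector_derivative D p) (at a)" for p
    by (simp add: has_vector_derivative_def D_def scaleR_sum_right)
  have "D p = 0" if "p \<in> ?P" "p \<noteq> id" for p
    unfolding D_def
  proof (rule sum.neutral, rule ballI)
    fix i :: 'n
    have "\<exists>j. j \<noteq> i \<and> p j \<noteq> j"
    proof (rule ccontr)
      assume "\<nexists>j. j \<noteq> i \<and> p j \<noteq> j"
      then have fx: "p j = j" if "j \<noteq> i" for j using that by auto
      have "inj p" using \<open>p \<in> ?P\<close> permutes_inj by auto
      then have "p i = i" using fx by (metis injD)
      then have "p = id" using fx by (metis eq_id_iff)
      then show False using that by simp
    qed
    then obtain j where "j \<noteq> i" "M a $ j $ p j = 0" using diag by metis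
    then have "(\<Prod>j\<in>UNIV - {i}. M a $ j $ p j) = 0" by (auto intro!: prod_zero)
    then show "M' i (p i) * (\<Prod>j\<in>UNIV - {i}. M a $ j $ p j) = 0" by simp
  qed
  then have "(\<Sum>p\<in>?P. of_int (sign p) * D p) = (\<Sum>p\<in>{id}. of_int (sign p) * D p)"
    by (intro sum.mono_neutral_right) (auto simp: permutes_id)
  also have "\<dots> = D id" by simp
  finally have "(\<Sum>p\<in>?P. of_int (sign p) * D p) = D id" .
  moreover have "((\<lambda>t. det (M t)) has_vector_derivative (\<Sum>p\<in>?P. of_int (sign p) * D p)) (at a)"
    unfolding det_def
    by (intro has_vector_derivative_sum has_vector_derivative_mult_right p)
  ultimately show ?thesis by (simp add: D_def)
qed

section \<open>The determinant at the imaginary unit\<close>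

lemma det_complex_of_real:
  fixes M :: "real ^ 'n ^ 'n"
  shows "det (\<chi> i j. complex_of_real (M $ i $ j)) = complex_of_real (det M)"
  by (simp add: det_def)

text \<open>Both sides are polynomials in \<open>z\<close> that agree at all real points.\<close>

lemma det_complex_charpoly:
  fixes M :: "real ^ 'n ^ 'n"
  assumes "charpoly M = (\<Prod>i\<in>UNIV. [:- l (i :: 'n), 1:])"
  shows "det (\<chi> i j. (if i = j then z else 0) - complex_of_real (M $ i $ j)) = (\<Prod>i\<in>UNIV. z - complex_of_real (l i))"
proof -
  define P :: "complex poly" where
    "P = det (\<chi> i j. (if i = j then [:0, 1:] else 0) - [: complex_of_real (M $ i $ j) :])"
  define Q where "Q = (\<Prod>i\<in>UNIV. [:- complex_of_real (l i), 1:])"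
  have P: "poly P w = det (\<chi> i j. (if i = j then w else 0) - complex_of_real (M $ i $ j))" for w
    unfolding P_def poly_det by (rule arg_cong[where f = det]) (simp add: vec_eq_iff)
  have Q: "poly Q w = (\<Prod>i\<in>UNIV. w - complex_of_real (l i))" for w
    by (simp add: Q_def poly_prod)
  have real: "poly (P - Q) (complex_of_real t) = 0" for t
  proof -
    have "poly P (complex_of_real t) = det (\<chi> i j. complex_of_real ((mat t - M) $ i $ j))"
      unfolding P by (rule arg_cong[where f = det]) (simp add: vec_eq_iff mat_def)
    also have "\<dots> = complex_of_real (\<Prod>i\<in>UNIV. t - l i)"
      unfolding det_complex_of_real poly_charpoly[symmetric] assms by (simp add: poly_prod)
    finally show ?thesis by (simp add: Q)
  qed
  have "P - Q = 0"
  proof (rule ccontr)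
    assume "P - Q \<noteq> 0"
    then have "finite {w. poly (P - Q) w = 0}" by (rule poly_roots_finite)
    moreover have "range complex_of_real \<subseteq> {w. poly (P - Q) w = 0}" using real by auto
    ultimately have "finite (range complex_of_real)" by (rule finite_subset[rotated])
    then show False
      using finite_imageD[OF _ inj_of_real] infinite_UNIV_char_0 by blast
  qed
  then show ?thesis using P[of z] Q[of z] by simp
qed

text \<open>The left side is \<open>\<i> * (1 + \<i> * l)\<close>, and \<open>1 + \<i> * l\<close>
  has modulus \<open>sqrt (1 + l\<^sup>2)\<close> and argument \<open>arctan l\<close>.\<close>

lemma complex_i_minus_polar:
  "\<i> - complex_of_real l = \<i> * (complex_of_real (sqrt (1 + l\<^sup>2)) * cis (arctan l))"
proof -
  have "sqrt (1 + l\<^sup>2) \<noteq> 0" by (simp add: add_nonneg_eq_0_iff)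
  then show ?thesis
    by (simp add: complex_eq_iff cos_arctan sin_arctan)
qed

text \<open>The polar forms of the factors multiply, so their arguments add up to the phase. Only
  the characteristic polynomial of \<open>M\<close> enters, so \<open>M\<close> may be
  \<open>A\<close> written in any orthonormal basis.\<close>

lemma charpoly_at_i:
  fixes M A :: "real ^ 'n ^ 'n"
  assumes "transpose A = A" and "charpoly M = charpoly A"
  shows "\<exists>r>0. det (\<chi> i j. (if i = j then \<i> else 0) - complex_of_real (M $ i $ j))
    = \<i> ^ CARD('n) * (complex_of_real r * cis (\<Sum>l\<in>#eigenvalues A. arctan l))"
proof -
  obtain e :: "'n \<Rightarrow> real ^ 'n" and l where e: "orthonormal_family e" "\<And>i. A *v e i = l i *\<^sub>R e i"
    using symmetric_matrix_orthonormal_eigenbasis[OF assms(1)] by blast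
  have th: "(\<Sum>l\<in>#eigenvalues A. arctan l) = (\<Sum>i\<in>UNIV. arctan (l i))"
    by (rule sum_eigenvalues_eigenbasis[OF e])
  have cs: "cis (sum f S) = (\<Prod>i\<in>S. cis (f i))" if "finite S" for f and S :: "'n set"
    using that by (induction S) (simp_all add: cis_mult[symmetric])
  have "det (\<chi> i j. (if i = j then \<i> else 0) - complex_of_real (M $ i $ j)) =
    (\<Prod>i\<in>UNIV. \<i> - complex_of_real (l i))"
    using assms(2) charpoly_eigenbasis[OF e] by (intro det_complex_charpoly) simp
  also have "\<dots> = \<i> ^ CARD('n) * (complex_of_real (\<Prod>i\<in>UNIV. sqrt (1 + (l i)\<^sup>2)) * cis (\<Sum>i\<in>UNIV. arctan (l i)))"
    unfolding complex_i_minus_polar by (simp add: prod.distrib cs)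
  finally show ?thesis
    unfolding th by (intro exI[of _ "\<Prod>i\<in>UNIV. sqrt (1 + (l i)\<^sup>2)"])
      (simp add: prod_pos add_pos_nonneg)
qed

text \<open>The sum \<open>\<theta>\<close> of the arctangents is the argument of \<open>X t = det (\<i> - A t) / \<i> ^ n\<close>, so its derivative
  is the imaginary part of the logarithmic derivative of \<open>X\<close>. In an eigenbasis of \<open>A a\<close> the latter
  is an explicit sum, and no differentiability of the individual eigenvalues is needed.\<close>

lemma phase_derivative:
  fixes A :: "real \<Rightarrow> real ^ 'n ^ 'n" and e :: "'n \<Rightarrow> real ^ 'n"
  assumes sym: "\<And>t. transpose (A t) = A t"
    and th: "((\<lambda>t. \<Sum>l\<in>#eigenvalues (A t). arctan l) has_real_derivative D) (at a)"
    and e: "orthonormal_family e" "\<And>i. A a *v e i = l i *\<^sub>R e i"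
    and H: "\<And>i j. ((\<lambda>t. e i \<bullet> (A t *v e j)) has_real_derivative H i j) (at a)"
  shows "D = (\<Sum>i\<in>UNIV. H i i / (1 + (l i)\<^sup>2))"
proof -
  define \<theta> where "\<theta> t = (\<Sum>l\<in>#eigenvalues (A t). arctan l)" for t
  define M :: "real \<Rightarrow> complex ^ 'n ^ 'n" where
    "M t = (\<chi> i j. (if i = j then \<i> else 0) - complex_of_real (in_basis e (A t) $ i $ j))" for t
  \<comment> \<open>Division by \<open>\<i> ^ CARD('n)\<close> removes the factors
    \<open>\<i>\<close> of the polar forms and leaves the argument \<open>\<theta>\<close>.\<close>
  define X where "X t = det (M t) / \<i> ^ CARD('n)" for t
  have polar: "\<exists>r>0. X t = complex_of_real r * cis (\<theta> t)" for t
    using charpoly_at_i[OF sym charpoly_in_basis[OF e(1)], of t] unfolding X_def M_def \<theta>_def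
    by (metis complex_i_not_zero nonzero_mult_div_cancel_left power_not_zero)
  have M: "M a $ i $ j = (if i = j then \<i> - complex_of_real (l i) else 0)" for i j
    using in_eigenbasis[of e "A a", OF e] by (simp add: M_def)
  have ne: "\<i> - complex_of_real (l i) \<noteq> 0" for i
    by (simp add: complex_eq_iff)
  define Y where "Y = (\<Sum>i\<in>UNIV. - complex_of_real (H i i) / (\<i> - complex_of_real (l i)))"
  have "((\<lambda>t. M t $ i $ j) has_vector_derivative - complex_of_real (H i j)) (at a)" for i j
  proof -
    have "((\<lambda>t. (if i = j then \<i> else 0) - complex_of_real (e i \<bullet> (A t *v e j)))
        has_vector_derivative 0 - complex_of_real (H i j)) (at a)"
      by (intro has_vector_derivative_diff has_vector_derivative_const has_vector_derivative_of_real
          H)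
    then show ?thesis by (simp add: M_def in_basis_def)
  qed
  then have "((\<lambda>t. det (M t)) has_vector_derivative
      (\<Sum>i\<in>UNIV. - complex_of_real (H i i) * (\<Prod>j\<in>UNIV - {i}. M a $ j $ j))) (at a)"
    by (rule det_has_vector_derivative_diagonal) (simp add: M)
  moreover have "- complex_of_real (H i i) * (\<Prod>j\<in>UNIV - {i}. M a $ j $ j)
      = det (M a) * (- complex_of_real (H i i) / (\<i> - complex_of_real (l i)))" for i
  proof -
    have "det (M a) = (\<Prod>j\<in>UNIV. M a $ j $ j)"
      by (rule det_diagonal) (simp add: M)
    also have "\<dots> = M a $ i $ i * (\<Prod>j\<in>UNIV - {i}. M a $ j $ j)"
      by (rule prod.remove) auto
    finally show ?thesis using ne[of i] by (simp add: M)
  qed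
  ultimately have "((\<lambda>t. det (M t)) has_vector_derivative det (M a) * Y) (at a)"
    by (simp add: Y_def sum_distrib_left)
  then have X': "(X has_vector_derivative X a * Y) (at a)"
    unfolding X_def[abs_def]
    using has_vector_derivative_divide[of _ _ _ "\<i> ^ CARD('n)"] by fastforce
  have re: "((\<lambda>t. Re (X t)) has_real_derivative Re (X a * Y)) (at a)"
    and im: "((\<lambda>t. Im (X t)) has_real_derivative Im (X a * Y)) (at a)"
    unfolding has_real_derivative_iff_has_vector_derivative
    by (rule bounded_linear.has_vector_derivative[OF bounded_linear_Re X']
        bounded_linear.has_vector_derivative[OF bounded_linear_Im X'])+
  \<comment> \<open>This expresses that \<open>X t\<close> is parallel to
    \<open>cis (\<theta> t)\<close> without choosing a branch of the argument; differentiating it at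
    \<open>a\<close> yields the equation for \<open>D\<close>.\<close>
  have "(\<lambda>t. Im (X t) * cos (\<theta> t) - Re (X t) * sin (\<theta> t)) = (\<lambda>t. 0)"
  proof
    fix t show "Im (X t) * cos (\<theta> t) - Re (X t) * sin (\<theta> t) = 0"
      using polar[of t] by auto
  qed
  moreover have th': "(\<theta> has_real_derivative D) (at a)"
    using th unfolding \<theta>_def .
  have "((\<lambda>t. Im (X t) * cos (\<theta> t) - Re (X t) * sin (\<theta> t)) has_real_derivative
      Im (X a * Y) * cos (\<theta> a) - Im (X a) * (sin (\<theta> a) * D)
      - (Re (X a * Y) * sin (\<theta> a) + Re (X a) * (cos (\<theta> a) * D))) (at a)"
    by (rule DERIV_cong[OF DERIV_diff[OF DERIV_mult[OF im DERIV_fun_cos[OF th']]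
          DERIV_mult[OF re DERIV_fun_sin[OF th']]]]) (simp add: algebra_simps)
  ultimately have z: "Im (X a * Y) * cos (\<theta> a) - Im (X a) * (sin (\<theta> a) * D)
      - (Re (X a * Y) * sin (\<theta> a) + Re (X a) * (cos (\<theta> a) * D)) = 0"
    using DERIV_unique DERIV_const by fastforce
  obtain r where r: "r > 0" "X a = complex_of_real r * cis (\<theta> a)" using polar by blast
  have X: "Re (X a) = r * cos (\<theta> a)" "Im (X a) = r * sin (\<theta> a)"
    by (simp_all add: r(2))
  have "r * (Im Y - D) = 0"
    using z[unfolded times_complex.sel X] sin_cos_squared_add[of "\<theta> a"] by algebra
  then have "D = Im Y" using r(1) by simp
  also have "Im Y = (\<Sum>i\<in>UNIV. H i i / (1 + (l i)\<^sup>2))"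
    by (simp add: Y_def Im_divide add.commute)
  finally show ?thesis .
qed

section \<open>A Liouville theorem\<close>

text \<open>A square matrix with orthonormal rows has orthonormal columns as well, so it preserves
  lengths.\<close>

lemma orthonormal_family_parseval:
  fixes e :: "'n \<Rightarrow> real ^ 'n"
  assumes "orthonormal_family e"
  shows "(\<Sum>i\<in>UNIV. (x \<bullet> e i)\<^sup>2) = x \<bullet> x"
proof -
  define Q :: "real ^ 'n ^ 'n" where "Q = (\<chi> i j. e i $ j)"
  have "Q ** transpose Q = mat 1"
    unfolding Q_def by (rule orthonormal_family_matrix[OF assms])
  then have QQ: "transpose Q ** Q = mat 1"
    by (simp add: matrix_left_right_inverse)
  have Q: "(Q *v x) $ i = x \<bullet> e i" for i
    by (simp add: Q_def matrix_vector_mult_def inner_vec_def mult.commute)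
  have "(\<Sum>i\<in>UNIV. (x \<bullet> e i)\<^sup>2) = (Q *v x) \<bullet> (Q *v x)"
    by (simp add: inner_vec_def Q power2_eq_square)
  also have "\<dots> = x \<bullet> ((transpose Q ** Q) *v x)"
    by (metis dot_lmul_matrix matrix_vector_mul_assoc transpose_matrix_vector transpose_transpose inner_commute)
  finally show ?thesis by (simp add: QQ)
qed

section \<open>Elliptic relations at a local maximum\<close>

text \<open>Just what the second derivative test on a line needs; no joint differentiability of
  \<open>f\<close> is demanded.\<close>

definition second_derivative_along :: "('a::real_vector \<Rightarrow> real) \<Rightarrow> 'a \<Rightarrow> 'a \<Rightarrow> real \<Rightarrow> bool" where
  "second_derivative_along f x v h \<longleftrightarrow>
    (\<exists>g'. (\<forall>t. ((\<lambda>t. f (x + t *\<^sub>R v)) has_real_derivative g' t) (at t)) \<and>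
      (g' has_real_derivative h) (at 0))"

text \<open>The second derivative test along \<open>e i\<close> bounds each \<open>H i\<close>,
  while the first-order condition along \<open>x\<close> fixes the radial derivative of
  \<open>\<Theta>\<close>. The relation between that derivative and the weighted sum of the
  \<open>H i\<close> joins the two.\<close>

lemma local_max_radial_barrier:
  fixes \<Theta> :: "'a::real_inner \<Rightarrow> real" and e :: "'i::finite \<Rightarrow> 'a"
  assumes e: "\<And>i. norm (e i) = 1" and w: "\<And>i. 0 \<le> w i"
    and H: "\<And>i. second_derivative_along \<Theta> x (e i) (H i)"
    and D: "((\<lambda>t. \<Theta> (x + t *\<^sub>R x)) has_real_derivative 2 * (\<Sum>i\<in>UNIV. w i * H i)) (at 0)"
    and f: "\<And>s. (f has_real_derivative f1 s) (at s)" "\<And>s. (f1 has_real_derivative f2 s) (at s)"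
    and "0 < d" and max: "\<And>y. dist y x < d \<Longrightarrow> \<Theta> y - f (y \<bullet> y) \<le> \<Theta> x - f (x \<bullet> x)"
  shows "f1 (x \<bullet> x) * (x \<bullet> x) \<le> (\<Sum>i\<in>UNIV. w i * (4 * f2 (x \<bullet> x) * (x \<bullet> e i)\<^sup>2 + 2 * f1 (x \<bullet> x)))"
proof -
  have Hle: "H i \<le> 4 * f2 (x \<bullet> x) * (x \<bullet> e i)\<^sup>2 + 2 * f1 (x \<bullet> x)" for i
  proof -
    define b where "b = x \<bullet> e i"
    have ee: "e i \<bullet> e i = 1" using e[of i] by (simp add: dot_square_norm)
    have s: "(x + t *\<^sub>R e i) \<bullet> (x + t *\<^sub>R e i) = x \<bullet> x + 2 * t * b + t * t" for t
      using ee by (simp add: inner_simps b_def inner_commute)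
    obtain g' where g': "\<And>t. ((\<lambda>t. \<Theta> (x + t *\<^sub>R e i)) has_real_derivative g' t) (at t)"
      "(g' has_real_derivative H i) (at 0)"
      using H[of i] unfolding second_derivative_along_def by blast
    have ds: "((\<lambda>t. x \<bullet> x + 2 * t * b + t * t) has_real_derivative (2 * b + 2 * t)) (at t)" for t
      by (auto intro!: derivative_eq_intros)
    have 1: "((\<lambda>t. \<Theta> (x + t *\<^sub>R e i) - f (x \<bullet> x + 2 * t * b + t * t)) has_real_derivative
        g' t - f1 (x \<bullet> x + 2 * t * b + t * t) * (2 * b + 2 * t)) (at t)" for t
      by (intro DERIV_diff g' DERIV_chain2[OF f(1) ds])
    have dl: "((\<lambda>t. 2 * b + 2 * t) has_real_derivative 2) (at 0)"
      by (auto intro!: derivative_eq_intros)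
    have 2: "((\<lambda>t. g' t - f1 (x \<bullet> x + 2 * t * b + t * t) * (2 * b + 2 * t)) has_real_derivative
        H i - (4 * f2 (x \<bullet> x) * b\<^sup>2 + 2 * f1 (x \<bullet> x))) (at 0)"
      by (rule DERIV_cong[OF DERIV_diff[OF g'(2) DERIV_mult[OF DERIV_chain2[OF f(2) ds] dl]]])
        (simp add: power2_eq_square algebra_simps)
    have "H i - (4 * f2 (x \<bullet> x) * b\<^sup>2 + 2 * f1 (x \<bullet> x)) \<le> 0"
    proof (rule second_derivative_local_max[OF 1 2 \<open>0 < d\<close>])
      fix t :: real assume "\<bar>t\<bar> < d"
      then have "dist (x + t *\<^sub>R e i) x < d" using e[of i] by (simp add: dist_norm)
      from max[OF this] show "\<Theta> (x + t *\<^sub>R e i) - f (x \<bullet> x + 2 * t * b + t * t)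
          \<le> \<Theta> (x + 0 *\<^sub>R e i) - f (x \<bullet> x + 2 * 0 * b + 0 * 0)"
        unfolding s by simp
    qed
    then show ?thesis by (simp add: b_def)
  qed
  have s: "(x + t *\<^sub>R x) \<bullet> (x + t *\<^sub>R x) = (1 + t) * (1 + t) * (x \<bullet> x)" for t
    by (simp add: inner_simps algebra_simps)
  have ds: "((\<lambda>t. (1 + t) * (1 + t) * (x \<bullet> x)) has_real_derivative 2 * (x \<bullet> x)) (at 0)"
    by (auto intro!: derivative_eq_intros)
  have "((\<lambda>t. \<Theta> (x + t *\<^sub>R x) - f ((1 + t) * (1 + t) * (x \<bullet> x))) has_real_derivative
      2 * (\<Sum>i\<in>UNIV. w i * H i) - f1 ((1 + 0) * (1 + 0) * (x \<bullet> x)) * (2 * (x \<bullet> x))) (at 0)"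
    by (intro DERIV_diff D DERIV_chain2[OF f(1) ds])
  moreover have "0 < d / (norm x + 1)" using \<open>0 < d\<close> by (simp add: add_nonneg_pos)
  moreover have "\<Theta> (x + t *\<^sub>R x) - f ((1 + t) * (1 + t) * (x \<bullet> x))
      \<le> \<Theta> (x + 0 *\<^sub>R x) - f ((1 + 0) * (1 + 0) * (x \<bullet> x))" if "\<bar>0 - t\<bar> < d / (norm x + 1)" for t
  proof -
    have "\<bar>t\<bar> * norm x \<le> \<bar>t\<bar> * (norm x + 1)" by (intro mult_left_mono) auto
    also have "\<dots> < d" using that by (simp add: pos_less_divide_eq add_nonneg_pos)
    finally have "dist (x + t *\<^sub>R x) x < d" by (simp add: dist_norm)
    from max[OF this] show ?thesis unfolding s by simp
  qed
  ultimately have "2 * (\<Sum>i\<in>UNIV. w i * H i) - f1 ((1 + 0) * (1 + 0) * (x \<bullet> x)) * (2 * (x \<bullet> x)) = 0"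
    using DERIV_local_max by blast
  then have "f1 (x \<bullet> x) * (x \<bullet> x) = (\<Sum>i\<in>UNIV. w i * H i)" by simp
  also have "\<dots> \<le> (\<Sum>i\<in>UNIV. w i * (4 * f2 (x \<bullet> x) * (x \<bullet> e i)\<^sup>2 + 2 * f1 (x \<bullet> x)))"
    by (intro sum_mono mult_left_mono Hle w)
  finally show ?thesis .
qed

text \<open>With \<open>w i\<close> the eigenvalues of a matrix \<open>a\<close> and \<open>e i\<close> its eigenvectors, the last line says
  \<open>tr (a D\<^sup>2\<Theta>) = 1/2 x \<cdot> D\<Theta>\<close> at \<open>x\<close>; below, \<open>a = (I + (D\<^sup>2u)\<^sup>2)\<^sup>-\<^sup>1\<close>.\<close>

definition elliptic_at :: "real \<Rightarrow> (real ^ 'n \<Rightarrow> real) \<Rightarrow> real ^ 'n \<Rightarrow> bool" where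
  "elliptic_at c \<Theta> x \<longleftrightarrow> (\<exists>(e :: 'n \<Rightarrow> real ^ 'n) w H.
    orthonormal_family e \<and> (\<forall>i. c \<le> w i \<and> w i \<le> 1) \<and>
    (\<forall>i. second_derivative_along \<Theta> x (e i) (H i)) \<and>
    ((\<lambda>t. \<Theta> (x + t *\<^sub>R x)) has_real_derivative 2 * (\<Sum>i\<in>UNIV. w i * H i)) (at 0))"

text \<open>The constant may decay as the ball grows, since no global bound on the Hessian is
  available.\<close>

definition locally_uniformly_elliptic :: "(real ^ 'n \<Rightarrow> real) \<Rightarrow> bool" where
  "locally_uniformly_elliptic \<Theta> \<longleftrightarrow> (\<forall>r. \<exists>c>0. \<forall>x. norm x \<le> r \<longrightarrow> elliptic_at c \<Theta> x)"

lemma second_derivative_along_uminus: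
  "second_derivative_along f x v h \<Longrightarrow> second_derivative_along (\<lambda>x. - f x) x v (- h)"
  unfolding second_derivative_along_def
  by (elim exE conjE, rule_tac x = "\<lambda>t. - g' t" in exI) (auto intro: DERIV_minus)

text \<open>The relation is linear in \<open>\<Theta>\<close>, so the same frame and weights serve
  for the negative. This turns an upper bound by the value at the origin into a lower one.\<close>

lemma elliptic_at_uminus:
  assumes "elliptic_at c \<Theta> x"
  shows "elliptic_at c (\<lambda>x. - \<Theta> x) x"
proof -
  from assms obtain e :: "'a \<Rightarrow> real ^ 'a" and w H
    where e: "orthonormal_family e" and w: "\<forall>i. c \<le> w i \<and> w i \<le> 1"
      and H: "\<forall>i. second_derivative_along \<Theta> x (e i) (H i)"
      and D: "((\<lambda>t. \<Theta> (x + t *\<^sub>R x)) has_real_derivative 2 * (\<Sum>i\<in>UNIV. w i * H i)) (at 0)"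
    unfolding elliptic_at_def by blast
  have "((\<lambda>t. - \<Theta> (x + t *\<^sub>R x)) has_real_derivative 2 * (\<Sum>i\<in>UNIV. w i * - H i)) (at 0)"
    using DERIV_minus[OF D] by (simp add: sum_negf)
  then show ?thesis
    unfolding elliptic_at_def using e w H
    by (intro exI[of _ e] exI[of _ w] exI[of _ "\<lambda>i. - H i"])
      (simp add: second_derivative_along_uminus)
qed

lemma locally_uniformly_elliptic_uminus:
  "locally_uniformly_elliptic \<Theta> \<Longrightarrow> locally_uniformly_elliptic (\<lambda>x. - \<Theta> x)"
  unfolding locally_uniformly_elliptic_def using elliptic_at_uminus by fast

text \<open>On \<open>[0, S]\<close> the logarithmic derivative of \<open>barrier'\<close> is at most \<open>- \<alpha> / 2\<close>, so ellipticity wins there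
  for large \<open>\<alpha>\<close>; beyond \<open>S > 2 n\<close> concavity suffices because of the drift. The linear term makes
  the barrier tend to infinity.\<close>

definition barrier :: "real \<Rightarrow> real \<Rightarrow> real \<Rightarrow> real" where
  "barrier \<alpha> S s = exp (- \<alpha> * S) * s - exp (- \<alpha> * s) / \<alpha>"

lemma barrier_derivative:
  assumes "\<alpha> > 0"
  shows "(barrier \<alpha> S has_real_derivative exp (- \<alpha> * S) + exp (- \<alpha> * s)) (at s)"
  unfolding barrier_def[abs_def] using assms
  by (auto intro!: derivative_eq_intros)

section \<open>Comparison with the barrier\<close>

text \<open>The condition on \<open>\<alpha>\<close> is tied to \<open>x \<bullet> x \<le> S\<close>
  because only there does the size of the ellipticity constant matter; farther out any positive
  constant will do.\<close>

lemma barrier_no_local_max: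
  fixes \<Theta> :: "real ^ 'n \<Rightarrow> real" and c \<kappa> \<alpha> S \<delta> d :: real
  assumes ell: "elliptic_at c \<Theta> x" "c > 0"
    and "\<kappa> > 0" "\<alpha> > 0" "S > 2 * CARD('n)" "\<delta> > 0" "norm x > \<delta>"
    and \<alpha>: "x \<bullet> x \<le> S \<Longrightarrow> CARD('n) \<le> \<alpha> * c * \<delta>\<^sup>2"
    and "0 < d" and max: "\<And>y. dist y x < d \<Longrightarrow>
      \<Theta> y - \<kappa> * barrier \<alpha> S (y \<bullet> y) \<le> \<Theta> x - \<kappa> * barrier \<alpha> S (x \<bullet> x)"
  shows False
proof -
  obtain e :: "'n \<Rightarrow> real ^ 'n" and w H
    where e: "orthonormal_family e" and cw: "\<And>i. c \<le> w i" "\<And>i. w i \<le> 1"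
      and H: "\<And>i. second_derivative_along \<Theta> x (e i) (H i)"
      and D: "((\<lambda>t. \<Theta> (x + t *\<^sub>R x)) has_real_derivative 2 * (\<Sum>i\<in>UNIV. w i * H i)) (at 0)"
    using ell unfolding elliptic_at_def by blast
  have w: "0 \<le> w i" for i using cw(1)[of i] \<open>c > 0\<close> by linarith
  define s where "s = x \<bullet> x"
  define E where "E = exp (- \<alpha> * s)"
  define f1 where "f1 = exp (- \<alpha> * S) + E"
  define n where "n = real CARD('n)"
  have n: "n > 0" by (simp add: n_def)
  have s\<delta>: "s > \<delta>\<^sup>2"
    using \<open>norm x > \<delta>\<close> \<open>\<delta> > 0\<close> unfolding s_def dot_square_norm by (intro power_strict_mono) auto
  have s0: "s > 0" using s\<delta> \<open>\<delta> > 0\<close> by (metis less_trans zero_less_power)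
  have E: "E > 0" "f1 > 0" by (auto simp: E_def f1_def add_pos_pos)
  have b: "((\<lambda>s. \<kappa> * barrier \<alpha> S s) has_real_derivative \<kappa> * (exp (- \<alpha> * S) + exp (- \<alpha> * r))) (at r)" for r
    by (intro DERIV_cmult barrier_derivative \<open>\<alpha> > 0\<close>)
  have b2: "((\<lambda>s. \<kappa> * (exp (- \<alpha> * S) + exp (- \<alpha> * s))) has_real_derivative \<kappa> * (- \<alpha> * exp (- \<alpha> * r))) (at r)" for r
    by (auto intro!: derivative_eq_intros)
  have ne: "norm (e i) = 1" for i
    using e by (simp add: orthonormal_family_def norm_eq_sqrt_inner)
  have "\<kappa> * f1 * s \<le> (\<Sum>i\<in>UNIV. w i * (4 * (\<kappa> * (- \<alpha> * E)) * (x \<bullet> e i)\<^sup>2 + 2 * (\<kappa> * f1)))"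
    using local_max_radial_barrier[where f = "\<lambda>s. \<kappa> * barrier \<alpha> S s" and e = e and w = w, OF ne w H D b b2 \<open>0 < d\<close> max]
    unfolding f1_def E_def s_def by blast
  also have "\<dots> = \<kappa> * (2 * f1 * (\<Sum>i\<in>UNIV. w i) - 4 * \<alpha> * E * (\<Sum>i\<in>UNIV. w i * (x \<bullet> e i)\<^sup>2))"
    unfolding sum_distrib_left right_diff_distrib sum_subtractf[symmetric]
    by (rule sum.cong) (simp_all add: algebra_simps)
  finally have "f1 * s \<le> 2 * f1 * (\<Sum>i\<in>UNIV. w i) - 4 * \<alpha> * E * (\<Sum>i\<in>UNIV. w i * (x \<bullet> e i)\<^sup>2)"
    using \<open>\<kappa> > 0\<close> by (simp add: mult.assoc)
  moreover have "(\<Sum>i\<in>UNIV. w i) \<le> n"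
    using sum_mono[of UNIV w "\<lambda>_. 1"] cw(2) by (simp add: n_def)
  ultimately have main: "f1 * s \<le> 2 * f1 * n - 4 * \<alpha> * E * (\<Sum>i\<in>UNIV. w i * (x \<bullet> e i)\<^sup>2)"
    using E(2) by (smt (verit) mult_left_mono)
  show False
  proof (cases "s \<le> S")
    \<comment> \<open>Here \<open>s > 2 * n\<close>, so the drift alone beats the trace of the
      weights; the concavity term only needs its sign.\<close>
    case False
    have "0 \<le> 4 * \<alpha> * E * (\<Sum>i\<in>UNIV. w i * (x \<bullet> e i)\<^sup>2)"
      using \<open>\<alpha> > 0\<close> E w by (intro mult_nonneg_nonneg sum_nonneg) auto
    then have "f1 * s \<le> f1 * (2 * n)" using main by (simp add: algebra_simps)
    then have "s \<le> 2 * n" using E(2) by simp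
    then show False using False \<open>S > 2 * CARD('n)\<close> by (simp add: n_def)
  next
    case True
    then have c: "\<alpha> * c * \<delta>\<^sup>2 \<ge> n"
      using \<alpha> by (auto simp: s_def n_def)
    \<comment> \<open>Parseval turns the lower bound \<open>c\<close> on the weights into a lower
      bound on the concavity term.\<close>
    have "c * \<delta>\<^sup>2 \<le> c * s" using \<open>c > 0\<close> s\<delta> by simp
    also have "\<dots> = (\<Sum>i\<in>UNIV. c * (x \<bullet> e i)\<^sup>2)"
      using orthonormal_family_parseval[OF e, of x] by (simp add: s_def flip: sum_distrib_left)
    also have "\<dots> \<le> (\<Sum>i\<in>UNIV. w i * (x \<bullet> e i)\<^sup>2)"
      by (intro sum_mono mult_right_mono cw) auto
    finally have "4 * \<alpha> * E * (c * \<delta>\<^sup>2) \<le> 4 * \<alpha> * E * (\<Sum>i\<in>UNIV. w i * (x \<bullet> e i)\<^sup>2)"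
      using \<open>\<alpha> > 0\<close> E by (intro mult_left_mono) auto
    moreover have "4 * E * n \<le> 4 * E * (\<alpha> * c * \<delta>\<^sup>2)"
      using c E by (intro mult_left_mono) auto
    moreover have "f1 \<le> 2 * E"
      using True \<open>\<alpha> > 0\<close> by (simp add: f1_def E_def)
    then have "2 * f1 * n \<le> 4 * E * n" using n by simp
    moreover have "f1 * s > 0" using E s0 by simp
    ultimately show False using main by (simp add: algebra_simps)
  qed
qed

text \<open>Order of the limits: for fixed \<open>\<eta>\<close>, \<open>\<delta>\<close> and
  \<open>\<alpha>\<close> the multiple \<open>\<kappa>\<close> of the barrier tends to 0, then
  \<open>\<eta>\<close> does. The upper bound on \<open>\<Theta>\<close> makes the maximum exist
  once the barrier is subtracted.\<close>

lemma elliptic_le_origin: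
  fixes \<Theta> :: "real ^ 'n \<Rightarrow> real"
  assumes ell: "locally_uniformly_elliptic \<Theta>" and cont: "continuous_on UNIV \<Theta>" and bd: "\<And>x. \<Theta> x \<le> K"
  shows "\<Theta> x0 \<le> \<Theta> 0"
proof (rule field_le_epsilon)
  fix \<eta> :: real assume "\<eta> > 0"
  have "isCont \<Theta> 0" using cont by (simp add: continuous_on_eq_continuous_at)
  then obtain \<delta>' where \<delta>': "\<delta>' > 0" "\<And>x. norm x < \<delta>' \<Longrightarrow> \<bar>\<Theta> x - \<Theta> 0\<bar> < \<eta>"
    using \<open>\<eta> > 0\<close> unfolding continuous_at_eps_delta dist_norm by fastforce
  define \<delta> where "\<delta> = \<delta>' / 2"
  have \<delta>: "\<delta> > 0" "\<And>x. norm x \<le> \<delta> \<Longrightarrow> \<Theta> x \<le> \<Theta> 0 + \<eta>"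
  proof -
    show "\<delta> > 0" using \<delta>' by (simp add: \<delta>_def)
    fix x :: "real ^ 'n" assume "norm x \<le> \<delta>"
    then have "norm x < \<delta>'" using \<delta>'(1) by (simp add: \<delta>_def)
    from \<delta>'(2)[OF this] show "\<Theta> x \<le> \<Theta> 0 + \<eta>" by linarith
  qed
  show "\<Theta> x0 \<le> \<Theta> 0 + \<eta>"
  proof (cases "norm x0 \<le> \<delta>")
    case False
    define S where "S = real (2 * CARD('n)) + 1"
    obtain c where c: "c > 0" and loc: "\<And>x. norm x \<le> sqrt S \<Longrightarrow> elliptic_at c \<Theta> x"
      using ell unfolding locally_uniformly_elliptic_def by meson
    \<comment> \<open>The smallest \<open>\<alpha>\<close> that \<open>barrier_no_local_max\<close>
      admits. It depends on \<open>c\<close> and \<open>\<delta>\<close> but not on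
      \<open>\<kappa>\<close>, so the barrier stays fixed as \<open>\<kappa>\<close>
      shrinks.\<close>
    define \<alpha> where "\<alpha> = real CARD('n) / (c * \<delta>\<^sup>2)"
    have \<alpha>: "\<alpha> > 0" "\<alpha> * c * \<delta>\<^sup>2 = real CARD('n)"
      using c \<delta>(1) by (auto simp: \<alpha>_def)
    let ?f = "barrier \<alpha> S"
    have bound: "\<Theta> x0 \<le> \<Theta> 0 + \<eta> + \<kappa> * (?f (x0 \<bullet> x0) - ?f (\<delta>\<^sup>2))" if \<kappa>: "\<kappa> > 0" for \<kappa>
    proof -
      define v where "v x = \<Theta> x - \<kappa> * ?f (x \<bullet> x)" for x
      define a where "a = \<kappa> * exp (- \<alpha> * S)"
      have a: "a > 0" using \<kappa> by (simp add: a_def)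
      have v_le: "v x \<le> K - a * (x \<bullet> x) + \<kappa> / \<alpha>" for x
      proof -
        have "exp (- \<alpha> * (x \<bullet> x)) \<le> 1" using \<alpha> by simp
        then have "\<kappa> * (exp (- \<alpha> * (x \<bullet> x)) / \<alpha>) \<le> \<kappa> * (1 / \<alpha>)"
          using \<kappa> \<alpha>(1) by (intro mult_left_mono divide_right_mono) auto
        then show ?thesis
          using bd[of x] by (simp add: v_def barrier_def a_def algebra_simps)
      qed
      \<comment> \<open>Outside radius \<open>R\<close> the growth of the barrier keeps
        \<open>v\<close> from exceeding \<open>v x0\<close>; \<open>R \<ge> 1\<close> allows passing
        from \<open>norm y\<close> to its square.\<close>
      define R where "R = max (max 1 (norm x0)) ((K + \<kappa> / \<alpha> - v x0) / a)"
      have R: "1 \<le> R" "norm x0 \<le> R" "K + \<kappa> / \<alpha> - v x0 \<le> a * R"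
      proof -
        have "(K + \<kappa> / \<alpha> - v x0) / a \<le> R" by (simp add: R_def)
        then show "K + \<kappa> / \<alpha> - v x0 \<le> a * R" using a by (simp add: pos_divide_le_eq mult.commute)
      qed (auto simp: R_def)
      define C where "C = cball 0 R - ball (0 :: real ^ 'n) \<delta>"
      have "compact C" unfolding C_def by (intro compact_diff) auto
      moreover have "x0 \<in> C" using False R by (simp add: C_def)
      moreover have "continuous_on C v"
        unfolding v_def[abs_def] barrier_def[abs_def] using \<alpha>(1)
        by (intro continuous_intros continuous_on_subset[OF cont]) auto
      ultimately obtain x1 where x1: "x1 \<in> C" "\<And>y. y \<in> C \<Longrightarrow> v y \<le> v x1"
        using continuous_attains_sup[of C v] by blast
      have max: "v y \<le> v x1" if "norm y \<ge> \<delta>" for y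
      proof (cases "norm y \<le> R")
        case True
        then show ?thesis using x1(2) that by (simp add: C_def)
      next
        case False
        then have "R * 1 \<le> norm y * norm y" using R(1) by (intro mult_mono) auto
        then have "a * R \<le> a * (y \<bullet> y)" using a by (simp add: dot_square_norm power2_eq_square)
        then have "v y \<le> v x0" using v_le[of y] R(3) by linarith
        then show ?thesis using x1(2)[OF \<open>x0 \<in> C\<close>] by linarith
      qed
      have "norm x1 = \<delta>"
      proof (rule ccontr)
        assume "norm x1 \<noteq> \<delta>"
        then have gt: "norm x1 > \<delta>" using x1(1) by (simp add: C_def)
        \<comment> \<open>Where the size of \<open>\<alpha>\<close> matters, the constant is the
          \<open>c\<close> from which \<open>\<alpha>\<close> was made; elsewhere the constant of a
          ball reaching \<open>x1\<close> suffices.\<close>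
        obtain c' where c': "c' > 0" "elliptic_at c' \<Theta> x1" "x1 \<bullet> x1 \<le> S \<Longrightarrow> c' = c"
        proof (cases "x1 \<bullet> x1 \<le> S")
          case True
          then have "norm x1 \<le> sqrt S" by (simp add: norm_eq_sqrt_inner)
          then show ?thesis using that c loc by blast
        next
          case False
          then show ?thesis
            using that ell unfolding locally_uniformly_elliptic_def by (meson order_refl)
        qed
        have "v y \<le> v x1" if "dist y x1 < norm x1 - \<delta>" for y
        proof -
          have "norm x1 \<le> norm y + dist y x1"
            by (metis dist_norm dist_commute norm_triangle_sub)
          then show ?thesis using that by (intro max) linarith
        qed
        then have m: "\<And>y. dist y x1 < norm x1 - \<delta> \<Longrightarrow>
            \<Theta> y - \<kappa> * ?f (y \<bullet> y) \<le> \<Theta> x1 - \<kappa> * ?f (x1 \<bullet> x1)"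
          by (simp add: v_def)
        show False
        proof (rule barrier_no_local_max[OF c'(2,1) \<kappa> \<alpha>(1) _ \<delta>(1) gt _ _ m])
          show "real (2 * CARD('n)) < S" by (simp add: S_def)
          show "0 < norm x1 - \<delta>" using gt by simp
          show "real CARD('n) \<le> \<alpha> * c' * \<delta>\<^sup>2" if "x1 \<bullet> x1 \<le> S"
            using \<alpha>(2) c'(3)[OF that] by simp
        qed
      qed
      then have "v x0 \<le> \<Theta> 0 + \<eta> - \<kappa> * ?f (\<delta>\<^sup>2)"
        using max[of x0] False \<delta>(2)[of x1] by (simp add: v_def dot_square_norm)
      then show ?thesis by (simp add: v_def algebra_simps)
    qed
    show ?thesis
    proof (rule field_le_epsilon)
      fix \<epsilon> :: real assume \<epsilon>: "\<epsilon> > 0"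
      \<comment> \<open>Whatever the sign of \<open>G\<close>, taking
        \<open>\<epsilon> / (\<bar>G\<bar> + 1)\<close> for \<open>\<kappa>\<close> makes the extra
        term at most \<open>\<epsilon>\<close>.\<close>
      define G where "G = ?f (x0 \<bullet> x0) - ?f (\<delta>\<^sup>2)"
      have "\<epsilon> / (\<bar>G\<bar> + 1) * G \<le> \<epsilon> / (\<bar>G\<bar> + 1) * (\<bar>G\<bar> + 1)"
        using \<epsilon> by (intro mult_left_mono) auto
      then have "\<epsilon> / (\<bar>G\<bar> + 1) * G \<le> \<epsilon>" by simp
      moreover have "\<epsilon> / (\<bar>G\<bar> + 1) > 0" using \<epsilon> by (simp add: add_nonneg_pos)
      ultimately show "\<Theta> x0 \<le> \<Theta> 0 + \<eta> + \<epsilon>"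
        using bound[of "\<epsilon> / (\<bar>G\<bar> + 1)"] by (simp add: G_def)
    qed
  qed (use \<delta> in auto)
qed

section \<open>The self-shrinker equation\<close>

lemma dird_eq_inner_gradient:
  assumes "u differentiable (at x)"
  shows "dird v u x = v \<bullet> gradient u x"
  using GDERIV_gradient[OF assms] unfolding gderiv_def dird_def
  by (metis frechet_derivative_at)

text \<open>Differentiating the gradient componentwise puts \<open>w\<close> outermost; commuting
  the derivatives exhibits the result as the gradient of \<open>dird w u\<close>.\<close>

lemma inner_hessian_eq_dird:
  assumes "smooth u"
  shows "v \<bullet> (hessian u x *v w) = dird v (dird w u) x"
proof -
  have "(gradient u has_derivative (\<lambda>h. \<chi> i. dird h (dird (axis i 1) u) x)) (at x)"
    unfolding has_derivative_componentwise_within[of "gradient u"]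
  proof
    fix b :: "real ^ 'a" assume "b \<in> Basis"
    then obtain i where b: "b = axis i 1" by (auto simp: Basis_vec_def)
    have "(dird b u has_derivative (\<lambda>h. dird h (dird b u) x)) (at x)"
      unfolding dird_def[of _ "dird b u"]
      using smooth_differentiable[OF smooth_dird[OF assms]] frechet_derivative_works by blast
    then show "((\<lambda>x. gradient u x \<bullet> b) has_derivative
        (\<lambda>h. (\<chi> i. dird h (dird (axis i 1) u) x) \<bullet> b)) (at x)"
      by (simp add: b inner_axis gradient_def dird_def[of "axis i 1" u, abs_def])
  qed
  then have F: "frechet_derivative (gradient u) (at x) = (\<lambda>h. \<chi> i. dird h (dird (axis i 1) u) x)"
    and lin: "linear (frechet_derivative (gradient u) (at x))"
    using frechet_derivative_at has_derivative_linear by metis+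
  have "hessian u x *v w = (\<chi> i. dird w (dird (axis i 1) u) x)"
    unfolding hessian_def using matrix_works[OF lin[folded linear_matrix_vector_mul_eq]] F by metis
  also have "\<dots> = (\<chi> i. dird (axis i 1) (dird w u) x)"
    using smooth_dird_commute[OF assms] by metis
  also have "\<dots> = gradient (dird w u) x"
    by (simp add: gradient_def dird_def)
  finally show ?thesis
    using dird_eq_inner_gradient[OF smooth_differentiable[OF smooth_dird[OF assms]]] by metis
qed

lemma hessian_component:
  assumes "smooth u"
  shows "hessian u x $ i $ j = dird (axis i 1) (dird (axis j 1) u) x"
proof -
  have "hessian u x $ i $ j = axis i 1 \<bullet> (hessian u x *v axis j 1)"
    by (simp add: inner_axis' matrix_vector_mult_basis column_def)
  then show ?thesis by (simp only: inner_hessian_eq_dird[OF assms])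
qed

lemma transpose_hessian:
  assumes "smooth u"
  shows "transpose (hessian u x) = hessian u x"
proof -
  have "hessian u x $ j $ i = hessian u x $ i $ j" for i j
    unfolding hessian_component[OF assms] by (rule fun_cong[OF smooth_dird_commute[OF assms]])
  then show ?thesis by (simp add: vec_eq_iff transpose_def)
qed

lemma abs_sum_arctan_eigenvalues_le:
  fixes A :: "real ^ 'n ^ 'n"
  assumes "transpose A = A"
  shows "\<bar>\<Sum>l\<in>#eigenvalues A. arctan l\<bar> \<le> CARD('n) * (pi / 2)"
proof -
  obtain e :: "'n \<Rightarrow> real ^ 'n" and l where e: "orthonormal_family e" "\<And>i. A *v e i = l i *\<^sub>R e i"
    using symmetric_matrix_orthonormal_eigenbasis[OF assms] by blast
  have "(\<Sum>l\<in>#eigenvalues A. arctan l) = (\<Sum>i\<in>UNIV. arctan (l i))"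
    by (rule sum_eigenvalues_eigenbasis[OF e])
  moreover have "\<bar>\<Sum>i\<in>UNIV. arctan (l i)\<bar> \<le> (\<Sum>i\<in>(UNIV :: 'n set). pi / 2)"
    by (intro order_trans[OF sum_abs] sum_mono) (use arctan_bounded in \<open>smt (verit)\<close>)
  ultimately show ?thesis by simp
qed

text \<open>A crude bound, chosen because the entries of the Hessian are continuous in
  \<open>x\<close>: compactness then bounds the eigenvalues on a ball without any continuity of the
  eigenvalues themselves.\<close>

lemma abs_eigenvalue_le_sum_components:
  fixes A :: "real ^ 'n ^ 'n"
  assumes "A *v v = l *\<^sub>R v" "norm v = 1"
  shows "\<bar>l\<bar> \<le> (\<Sum>i\<in>UNIV. \<Sum>j\<in>UNIV. \<bar>A $ i $ j\<bar>)"
proof -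
  have v: "\<bar>v $ i\<bar> \<le> 1" for i using component_le_norm_cart[of v i] assms(2) by simp
  have "l = v \<bullet> (A *v v)" using assms by (simp add: dot_square_norm)
  also have "\<dots> = (\<Sum>i\<in>UNIV. \<Sum>j\<in>UNIV. v $ i * (A $ i $ j * v $ j))"
    by (simp add: inner_vec_def matrix_vector_mult_def sum_distrib_left)
  finally have "\<bar>l\<bar> = \<bar>\<Sum>i\<in>UNIV. \<Sum>j\<in>UNIV. v $ i * (A $ i $ j * v $ j)\<bar>" by simp
  also have "\<dots> \<le> (\<Sum>i\<in>UNIV. \<Sum>j\<in>UNIV. \<bar>v $ i * (A $ i $ j * v $ j)\<bar>)"
    by (rule order_trans[OF sum_abs sum_mono[OF sum_abs]])
  also have "\<dots> \<le> (\<Sum>i\<in>UNIV. \<Sum>j\<in>UNIV. 1 * (\<bar>A $ i $ j\<bar> * 1))"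
    unfolding abs_mult by (intro sum_mono mult_mono v) auto
  finally show ?thesis by simp
qed

section \<open>The elliptic equation of the phase\<close>

text \<open>The function \<open>\<Theta>\<close> of the introduction. Differentiability is read off
  this side of the equation, boundedness off the sum of arctangents.\<close>

definition self_similar_speed :: "(real ^ 'n \<Rightarrow> real) \<Rightarrow> real ^ 'n \<Rightarrow> real" where
  "self_similar_speed u x = 1 / 2 * (x \<bullet> gradient u x) - u x"

lemma self_similar_speed_dird:
  "smooth u \<Longrightarrow> self_similar_speed u x = 1 / 2 * dird x u x - u x"
  by (simp add: self_similar_speed_def dird_eq_inner_gradient smooth_differentiable)

text \<open>The product rule leaves half of \<open>dird v u\<close> with a minus sign after one
  differentiation; after the second, all second-order terms cancel. Only third derivatives of
  \<open>u\<close> remain, and \<open>x\<close> can be moved outermost.\<close>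

lemma self_similar_speed_second_derivative:
  assumes "smooth u"
  shows "second_derivative_along (self_similar_speed u) x v (1 / 2 * dird x (dird v (dird v u)) x)"
proof -
  have line: "((\<lambda>t. f (x + t *\<^sub>R v)) has_real_derivative dird v f (x + t *\<^sub>R v)) (at t)"
    if "smooth f" for f :: "real ^ 'a \<Rightarrow> real" and t
    using has_real_derivative_along_line smooth_differentiable[OF that] by blast
  \<comment> \<open>Linearity in the direction separates the fixed direction \<open>x\<close> from
    the moving part \<open>t *\<^sub>R v\<close>.\<close>
  have eq: "self_similar_speed u (x + t *\<^sub>R v) =
    1 / 2 * (dird x u (x + t *\<^sub>R v) + t * dird v u (x + t *\<^sub>R v)) - u (x + t *\<^sub>R v)" for t
    by (simp add: self_similar_speed_dird dird_add dird_scaleR smooth_differentiable assms)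
  define g' where "g' t = 1 / 2 * (dird v (dird x u) (x + t *\<^sub>R v) + t * dird v (dird v u) (x + t *\<^sub>R v))
    - 1 / 2 * dird v u (x + t *\<^sub>R v)" for t
  have "((\<lambda>t. self_similar_speed u (x + t *\<^sub>R v)) has_real_derivative g' t) (at t)" for t
    unfolding eq g'_def
    by (rule derivative_eq_intros line smooth_dird assms refl)+ (simp add: algebra_simps)
  moreover have "(g' has_real_derivative 1 / 2 * dird v (dird v (dird x u)) x) (at 0)"
    unfolding g'_def[abs_def]
    by (rule derivative_eq_intros line smooth_dird assms refl)+ (simp add: algebra_simps)
  moreover have "dird v (dird v (dird x u)) = dird x (dird v (dird v u))"
    using smooth_dird_commute[OF assms] smooth_dird_commute[OF smooth_dird[OF assms]] by metis
  ultimately show ?thesis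
    unfolding second_derivative_along_def by metis
qed

text \<open>In an eigenbasis of the Hessian the same third derivatives \<open>H i i\<close> occur
  twice: weighted by \<open>1 / (1 + (l i)\<^sup>2)\<close> in the radial derivative of the phase,
  and halved as second derivatives along \<open>e i\<close>.\<close>

lemma self_similar_speed_elliptic_at:
  fixes u :: "real ^ 'n \<Rightarrow> real"
  assumes u: "smooth u"
    and eq: "\<And>x. (\<Sum>l\<in>#eigenvalues (hessian u x). arctan l) = self_similar_speed u x"
    and M: "(\<Sum>i\<in>UNIV. \<Sum>j\<in>UNIV. \<bar>hessian u x $ i $ j\<bar>) \<le> M"
  shows "elliptic_at (1 / (1 + M\<^sup>2)) (self_similar_speed u) x"
proof -
  note sm = smooth_dird smooth_differentiable u
  obtain e :: "'n \<Rightarrow> real ^ 'n" and l where e: "orthonormal_family e"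
    and l: "\<And>i. hessian u x *v e i = l i *\<^sub>R e i"
    using symmetric_matrix_orthonormal_eigenbasis[OF transpose_hessian[OF u]] by blast
  have ne: "norm (e i) = 1" for i
    using e by (simp add: orthonormal_family_def norm_eq_sqrt_inner)
  have "(l i)\<^sup>2 \<le> M\<^sup>2" for i
    using abs_eigenvalue_le_sum_components[OF l ne, of i] M by (intro abs_le_square_iff[THEN iffD1]) linarith
  then have w: "1 / (1 + M\<^sup>2) \<le> 1 / (1 + (l i)\<^sup>2) \<and> 1 / (1 + (l i)\<^sup>2) \<le> 1" for i
    by (auto intro!: divide_left_mono mult_pos_pos add_pos_nonneg simp: divide_le_eq add_pos_nonneg)
  define H where "H i j = dird x (dird (e i) (dird (e j) u)) x" for i j
  \<comment> \<open>Through the equation, the sum of arctangents inherits its differentiability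
    along the ray from the smooth side.\<close>
  obtain D where D: "((\<lambda>t. self_similar_speed u (x + t *\<^sub>R x)) has_real_derivative D) (at 0)"
    using self_similar_speed_second_derivative[OF u] unfolding second_derivative_along_def by blast
  have "D = (\<Sum>i\<in>UNIV. H i i / (1 + (l i)\<^sup>2))"
  proof (rule phase_derivative[where A = "\<lambda>t. hessian u (x + t *\<^sub>R x)" and a = 0 and e = e and l = l and H = H])
    show "((\<lambda>t. e i \<bullet> (hessian u (x + t *\<^sub>R x) *v e j)) has_real_derivative H i j) (at 0)" for i j
      unfolding inner_hessian_eq_dird[OF u] H_def
      using has_real_derivative_along_line[of "dird (e i) (dird (e j) u)" x 0 x] by (simp add: sm)
  qed (use D e l in \<open>simp_all add: eq transpose_hessian[OF u]\<close>)
  also have "\<dots> = 2 * (\<Sum>i\<in>UNIV. 1 / (1 + (l i)\<^sup>2) * (1 / 2 * H i i))"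
    unfolding sum_distrib_left by (rule sum.cong) (simp_all add: divide_simps)
  finally have "((\<lambda>t. self_similar_speed u (x + t *\<^sub>R x)) has_real_derivative
      2 * (\<Sum>i\<in>UNIV. 1 / (1 + (l i)\<^sup>2) * (1 / 2 * H i i))) (at 0)"
    using D by simp
  moreover have "second_derivative_along (self_similar_speed u) x (e i) (1 / 2 * H i i)" for i
    unfolding H_def by (rule self_similar_speed_second_derivative[OF u])
  ultimately show ?thesis
    unfolding elliptic_at_def using e w
    by (intro exI[of _ e] exI[of _ "\<lambda>i. 1 / (1 + (l i)\<^sup>2)"] exI[of _ "\<lambda>i. 1 / 2 * H i i"] conjI allI) auto
qed

lemma self_similar_speed_elliptic:
  fixes u :: "real ^ 'n \<Rightarrow> real"
  assumes u: "smooth u"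
    and eq: "\<And>x. (\<Sum>l\<in>#eigenvalues (hessian u x). arctan l) = self_similar_speed u x"
  shows "locally_uniformly_elliptic (self_similar_speed u)"
  unfolding locally_uniformly_elliptic_def
proof
  fix r
  have "continuous_on (cball 0 r) (\<lambda>x. \<Sum>i\<in>UNIV. \<Sum>j\<in>UNIV. \<bar>hessian u x $ i $ j\<bar>)"
    unfolding hessian_component[OF u]
    by (intro continuous_intros smooth_continuous_on smooth_dird u)
  then have "bounded ((\<lambda>x. \<Sum>i\<in>UNIV. \<Sum>j\<in>UNIV. \<bar>hessian u x $ i $ j\<bar>) ` cball 0 r)"
    by (intro compact_imp_bounded compact_continuous_image) auto
  then obtain M where M: "\<forall>x\<in>cball 0 r. \<bar>\<Sum>i\<in>UNIV. \<Sum>j\<in>UNIV. \<bar>hessian u x $ i $ j\<bar>\<bar> \<le> M"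
    by (auto simp: bounded_iff)
  have "\<And>x. norm x \<le> r \<Longrightarrow> elliptic_at (1 / (1 + M\<^sup>2)) (self_similar_speed u) x"
    by (intro self_similar_speed_elliptic_at[OF u eq]) (use M in \<open>auto simp: abs_le_iff\<close>)
  moreover have "1 / (1 + M\<^sup>2) > 0" by (simp add: add_pos_nonneg)
  ultimately show "\<exists>c>0. \<forall>x. norm x \<le> r \<longrightarrow> elliptic_at c (self_similar_speed u) x" by blast
qed

section \<open>Constancy of the phase and the quadratic form\<close>

lemma self_similar_speed_constant:
  fixes u :: "real ^ 'n \<Rightarrow> real"
  assumes u: "smooth u"
    and eq: "\<And>x. (\<Sum>l\<in>#eigenvalues (hessian u x). arctan l) = self_similar_speed u x"
  shows "self_similar_speed u x = self_similar_speed u 0"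
proof (rule antisym)
  have "continuous_on UNIV (\<lambda>x. 1 / 2 * (\<Sum>i\<in>UNIV. x $ i * dird (axis i 1) u x) - u x)"
    by (intro continuous_intros smooth_continuous_on smooth_dird u)
  then have cont: "continuous_on UNIV (self_similar_speed u)"
    by (simp add: self_similar_speed_def[abs_def] inner_vec_def gradient_def dird_def)
  have bd: "\<bar>self_similar_speed u x\<bar> \<le> CARD('n) * (pi / 2)" for x
    using abs_sum_arctan_eigenvalues_le[OF transpose_hessian[OF u]] eq by metis
  note ell = self_similar_speed_elliptic[OF u eq]
  show "self_similar_speed u x \<le> self_similar_speed u 0"
    by (rule elliptic_le_origin[OF ell cont, where K = "CARD('n) * (pi / 2)"]) (use bd abs_le_iff in blast)
  have "- self_similar_speed u x \<le> - self_similar_speed u 0"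
    by (rule elliptic_le_origin[OF locally_uniformly_elliptic_uminus[OF ell] continuous_on_minus[OF cont],
        where K = "CARD('n) * (pi / 2)"])
      (use bd abs_le_iff in blast)
  then show "self_similar_speed u 0 \<le> self_similar_speed u x" by simp
qed

theorem theorem1p1:
  fixes u :: "real ^ 'n \<Rightarrow> real"
  assumes "smooth u"
    and "\<forall>x. (\<Sum>l\<in>#eigenvalues (hessian u x). arctan l) = 1 / 2 * (x \<bullet> gradient u x) - u x"
  shows "\<forall>x. u x = u 0 + 1 / 2 * ((hessian u 0 *v x) \<bullet> x)"
proof
  fix x
  have df: "u differentiable (at y)" for y by (rule smooth_differentiable[OF assms(1)])
  \<comment> \<open>Subtracting the value at the origin turns the constancy of the speed, with value
    \<open>- u 0\<close>, into Euler's relation of degree two.\<close>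
  define f where "f y = u y - u 0" for y
  have f: "f differentiable (at y)" for y
    unfolding f_def[abs_def] by (intro derivative_intros df)
  have "(f has_derivative frechet_derivative u (at y)) (at y)" for y
    unfolding f_def[abs_def] using has_derivative_diff[OF df[of y, unfolded frechet_derivative_works] has_derivative_const]
    by simp
  then have "frechet_derivative f (at y) = frechet_derivative u (at y)" for y
    by (metis frechet_derivative_at)
  then have dird: "dird v f = dird v u" for v
    by (simp add: dird_def fun_eq_iff)
  have "self_similar_speed u y = self_similar_speed u 0" for y
    using assms(2) by (intro self_similar_speed_constant[OF assms(1)]) (simp add: self_similar_speed_def)
  moreover have "self_similar_speed u 0 = - u 0" by (simp add: self_similar_speed_def)
  ultimately have e: "dird y f y = 2 * f y" for y
    using self_similar_speed_dird[OF assms(1), of y] unfolding dird by (simp add: f_def)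
  have g: "dird y f differentiable (at 0)" for y
    unfolding dird by (rule smooth_differentiable[OF smooth_dird[OF assms(1)]])
  have "f 0 = 0" by (simp add: f_def)
  from radial_derivative_double[OF f this e g]
  have "f x = 1 / 2 * dird x (dird x f) 0" .
  then show "u x = u 0 + 1 / 2 * ((hessian u 0 *v x) \<bullet> x)"
    by (simp add: f_def dird inner_commute[of _ x] inner_hessian_eq_dird[OF assms(1)])
qed

end
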